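(* Let $f:\mathbb{R}^d\to\mathbb{R}$ be convex and twice differentiable, let $r:\mathbb{R}^d\to\mathbb{R}\cup\{+\infty\}$ be convex, and let $F=f+r$. Suppose: (1) (exactly sparse gradients) $\|\nabla f(x)\|_0\le s_{\mathrm{exact}}$ for all $x\in\mathbb{R}^d$; (2) (weakly sparse Hessian) there is a constant $H$ with $\|\nabla^2 f(x)\|_1\le H$ for all $x\in\mathbb{R}^d$; (3) the solution set $\mathcal{X}^\star=\{x^\star: F(x^\star)=F^\star\}$ is non-empty, where $F^\star=\min_xF(x)$, and $\|\nabla f(x)-\nabla f(y)\|_2\le L\|x-y\|_2$ for all $x,y\in\mathbb{R}^d$; (4) the oracle noise satisfies $|\xi|\le\sigma$ at every call; (5) $F$ is coercive: $\lim_k\|x_k-\mathrm{P}_\star(x_k)\|_2=+\infty$ implies $\lim_k F(x_k)=+\infty$, for any sequence $\{x_k\}$; (6) $\partial F$ is coercive with respect to $F$: $\lim_kF(x_k)=+\infty$ implies $\lim_k\inf_{u\in\partial F(x_k)}\|u\|_2=+\infty$, for any sequence $\{x_k\}$. Choose $s\ge s_{\mathrm{exact}}$ and $\alpha=\frac1L$. Let $e_0=F(x_0)-F^\star$ and let $R$ be the constant, determined by the coercivity conditions (5) and (6), satisfying $\|x_k-\mathrm{P}_\star(x_k)\|_2\le R$ for all iterates $x_k$ of ZORO. Then ZORO finds an $\varepsilon$-optimal solution in $$b_1s\log(d)\left(\frac{36LR^2}{\varepsilon}+\log(e_0)\right)$$ queries, for any $\varepsilon\ge b_5R\sqrt{\sigma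 H}$. If instead of (5) and (6) $F$ is restricted $\nu$-strongly convex, i.e. $F(x)-\min F\ge\frac\nu2\|x-\mathrm{P}_\star(x)\|_2^2$ for all $x\in\mathbb{R}^d$, then this query complexity improves to $$\frac{b_1s\log(d)\,\log\left(\frac{\varepsilon\nu-b_5^2\sigma H}{\nu e_0}\right)}{\log(24L)-\log(\nu+24L)}=O\left(s\log(d)\log\left(\tfrac1\varepsilon\right)\right)$$ for any $\varepsilon>b_5^2\sigma H/\nu$. Both query complexities hold with probability (at least) $1-2(s/d)^{b_2s}$.
   Context: Notation: $\|\cdot\|_0$ counts nonzero entries; $\|\cdot\|_1$ is the entry-wise $\ell_1$ norm (for vectors and matrices); $[v]_{(s)}$ is the best $s$-sparse approximation of $v$ in $\ell_2$. $\mathrm{P}_\star(x)$ is the nearest point to $x$ in $\mathcal{X}^\star$. $\partial F(x)=\nabla f(x)+\partial r(x)$, with $\partial r$ the convex subdifferential. $x_k$ is $\varepsilon$-optimal if $F(x_k)-F^\star\le\varepsilon$. Oracle: $f$ is accessible only through noisy evaluations $E_f(x)=f(x)+\xi$, where $\xi$ changes at each call and may be adversarial (not zero-mean). A query is one call to the oracle. The function $r$ is known explicitly and its proximal operator can be computed exactly. ZORO (inputs: initial point $x_0$, sparsity level $s$, step size $\alpha$, query radius $\delta$): set $m=b_1 s\log(d/s)$; draw i.i.d. Rademacher vectors $z_1,\dots,z_m\in\{\pm1\}^d$ once, and let $Z\in\mathbb{R}^{m\times d}$ have rows $\frac1{\sqrt m}z_i^\top$. At iteration $k$: form $y\in\mathbb{R}^m$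 with $y_i=\frac{1}{\sqrt m}\,\frac{E_f(x_k+\delta z_i)-E_f(x_k)}{\delta}$; compute $\hat g_k$ as the output of $n$ iterations of CoSaMP on $\min_{\|g\|_0\le s}\|Zg-y\|_2$; set $x_{k+1}=\mathrm{prox}_{\alpha r}(x_k-\alpha\hat g_k)$, where $\mathrm{prox}_{\alpha r}(x)=\mathrm{argmin}_y\frac12\|x-y\|_2^2+\alpha r(y)$. The query radius is $\delta=2\sqrt{\sigma/H}$ and $n$ is taken sufficiently large (so that $\rho^n\|\nabla f(x_k)\|_2\le\tau\sqrt{\sigma H}$ for all $k$, with $\rho,\tau$ below). CoSaMP: start from $g^0=0$; given $g^j$, let $U=\mathrm{supp}(g^j)\cup\mathrm{supp}([Z^\top(y-Zg^j)]_{(2s)})$, let $u$ minimize $\|y-Zv\|_2$ over $v$ supported in $U$, and set $g^{j+1}=[u]_{(s)}$. Constants: $Z$ has the $4s$-RIP with constant $\delta_{4s}(Z)\in(0,1)$ if $(1-\delta_{4s}(Z))\|v\|_2^2\le\|Zv\|_2^2\le(1+\delta_{4s}(Z))\|v\|_2^2$ for all $v$ with $\|v\|_0\le 4s$. $b_1,b_2$ are constants (independent of $s,d,m$) for which, by a known theorem, the random matrix $Z\in\mathbb{R}^{m\times d}$ with rows $\frac1{\sqrt m}z_i^\top$, where $m=b_1s\log(d/s)$ and $z_1,\dots,z_m\in\{\pm1\}^d$ are i.i.d. Rademacher vectors, has the $4s$-RIP with $\delta_{4s}(Z)\le0.3843$ with probability (at least) $1-2(s/d)^{b_2s}$. $\rho<1$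 and $\tau\approx10$ are the constants, depending only on $\delta_{4s}$, in the known CoSaMP guarantee: on the event that $Z$ has the $4s$-RIP with $\delta_{4s}(Z)\le0.3843$, for all $g\in\mathbb{R}^d$ and $y=Zg+e$, $\|g^n-g\|_2\le\|g-[g]_{(s)}\|_2+\tau\|Z(g-[g]_{(s)})\|_2+\tau\|e\|_2+\rho^n\|[g]_{(s)}\|_2$. $b_5$ is a constant arising from the use of compressed sensing to reconstruct the gradient; it depends only on the compressed sensing algorithm used (CoSaMP) and the number of iterations it is run for, not on $F$ or $\varepsilon$.
   Formalization: log(e_0) in the first bound is replaced by max(0, log e_0), as the literal bound can be negative for e_0<1; queries are counted in whole iterations of m+1, rounded up; the O-bound is for ε→0 with b_5²σH/ν ≤ θε for a fixed θ<1. *)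

theory Defs
  imports "HOL-Probability.Probability" "HOL-Library.Landau_Symbols"
begin

subsection \<open>Sparsity\<close>

definition supp :: "real^'d \<Rightarrow> 'd set" where
  "supp v = {i. v $ i \<noteq> 0}"

definition l0_norm :: "real^'d \<Rightarrow> nat" where
  "l0_norm v = card (supp v)"

definition entrywise_l1 :: "real^'d^'d \<Rightarrow> real" where
  "entrywise_l1 A = (\<Sum>i\<in>UNIV. \<Sum>j\<in>UNIV. \<bar>A $ i $ j\<bar>)"

text \<open>\<open>w = [v]\<^sub>(\<^sub>s\<^sub>)\<close>. The best sparse approximation need not be unique when entries tie, hence
  a relation; everything below is stated for every way of breaking the ties.\<close>

definition best_sparse :: "nat \<Rightarrow> real^'d \<Rightarrow> real^'d \<Rightarrow> bool" where
  "best_sparse s v w \<longleftrightarrow> is_arg_min (\<lambda>w'. norm (v - w')) (\<lambda>w'. l0_norm w' \<le> s) w"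


subsection \<open>The measurement matrix\<close>

text \<open>The number of rows \<open>m\<close> depends on the data, so vectors in \<open>\<real>\<^sup>m\<close> are functions on
  \<open>nat\<close> of which only the values below \<open>m\<close> matter, with norm \<open>L2_set _ {..<m}\<close>. The matrix \<open>Z\<close> with
  rows \<open>z i / sqrt m\<close> is represented by the family \<open>z\<close>.\<close>

definition Z_mult :: "nat \<Rightarrow> (nat \<Rightarrow> real^'d) \<Rightarrow> real^'d \<Rightarrow> nat \<Rightarrow> real" where
  "Z_mult m z v = (\<lambda>i. (z i \<bullet> v) / sqrt (real m))"

definition Zt_mult :: "nat \<Rightarrow> (nat \<Rightarrow> real^'d) \<Rightarrow> (nat \<Rightarrow> real) \<Rightarrow> real^'d" where
  "Zt_mult m z w = (\<Sum>i<m. (w i / sqrt (real m)) *\<^sub>R z i)"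

definition RIP :: "nat \<Rightarrow> real \<Rightarrow> nat \<Rightarrow> (nat \<Rightarrow> real^'d) \<Rightarrow> bool" where
  "RIP k dlt m z \<longleftrightarrow> 0 < dlt \<and> dlt < 1 \<and>
     (\<forall>v. l0_norm v \<le> k \<longrightarrow>
        (1 - dlt) * (norm v)\<^sup>2 \<le> (L2_set (Z_mult m z v) {..<m})\<^sup>2 \<and>
        (L2_set (Z_mult m z v) {..<m})\<^sup>2 \<le> (1 + dlt) * (norm v)\<^sup>2)"

definition good_matrix :: "nat \<Rightarrow> nat \<Rightarrow> (nat \<Rightarrow> real^'d) \<Rightarrow> bool" where
  "good_matrix s m z \<longleftrightarrow> (\<exists>dlt \<le> 0.3843. RIP (4 * s) dlt m z)"

definition rademacher_vector :: "(real^'d) pmf" where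
  "rademacher_vector = pmf_of_set {v. \<forall>j. v $ j \<in> {-1, 1}}"

text \<open>\<open>m\<close> i.i.d. Rademacher vectors \<open>z 0, \<dots>, z (m - 1)\<close>.\<close>

definition rademacher_family :: "nat \<Rightarrow> (nat \<Rightarrow> real^'d) pmf" where
  "rademacher_family m = Pi_pmf {..<m} 0 (\<lambda>_. rademacher_vector)"


subsection \<open>CoSaMP\<close>

definition cosamp_step ::
  "nat \<Rightarrow> nat \<Rightarrow> (nat \<Rightarrow> real^'d) \<Rightarrow> (nat \<Rightarrow> real) \<Rightarrow> real^'d \<Rightarrow> real^'d \<Rightarrow> bool" where
  "cosamp_step s m z y g g' \<longleftrightarrow>
     (\<exists>h u. best_sparse (2 * s) (Zt_mult m z (\<lambda>i. y i - Z_mult m z g i)) h \<and>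
        is_arg_min (\<lambda>v. L2_set (\<lambda>i. y i - Z_mult m z v i) {..<m})
                   (\<lambda>v. supp v \<subseteq> supp g \<union> supp h) u \<and>
        best_sparse s u g')"

definition cosamp_output ::
  "nat \<Rightarrow> nat \<Rightarrow> (nat \<Rightarrow> real^'d) \<Rightarrow> (nat \<Rightarrow> real) \<Rightarrow> nat \<Rightarrow> real^'d \<Rightarrow> bool" where
  "cosamp_output s m z y n g \<longleftrightarrow>
     (\<exists>G. G 0 = 0 \<and> (\<forall>j<n. cosamp_step s m z y (G j) (G (Suc j))) \<and> g = G n)"

text \<open>The property defining the constants \<open>\<rho>\<close> and \<open>\<tau>\<close>. The type argument fixes the dimension.\<close>

definition cosamp_guarantee :: "'d::finite itself \<Rightarrow> nat \<Rightarrow> nat \<Rightarrow> real \<Rightarrow> real \<Rightarrow> bool" where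
  "cosamp_guarantee _ s m \<rho> \<tau> \<longleftrightarrow>
     (\<forall>(z :: nat \<Rightarrow> real^'d) g gs e j out. good_matrix s m z \<longrightarrow> best_sparse s g gs \<longrightarrow>
        cosamp_output s m z (\<lambda>i. Z_mult m z g i + e i) j out \<longrightarrow>
        norm (out - g) \<le> norm (g - gs) + \<tau> * L2_set (Z_mult m z (g - gs)) {..<m}
                          + \<tau> * L2_set e {..<m} + \<rho> ^ j * norm gs)"


subsection \<open>Convex analysis with extended values\<close>

definition convex_ereal :: "(real^'d \<Rightarrow> ereal) \<Rightarrow> bool" where
  "convex_ereal r \<longleftrightarrow> (\<forall>x y. \<forall>t\<in>{0..1::real}.
     r ((1 - t) *\<^sub>R x + t *\<^sub>R y) \<le> ereal (1 - t) * r x + ereal t * r y)"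

definition subdifferential :: "(real^'d \<Rightarrow> ereal) \<Rightarrow> real^'d \<Rightarrow> (real^'d) set" where
  "subdifferential r x = {u. \<forall>y. r x + ereal (u \<bullet> (y - x)) \<le> r y}"

definition is_prox :: "real \<Rightarrow> (real^'d \<Rightarrow> ereal) \<Rightarrow> real^'d \<Rightarrow> real^'d \<Rightarrow> bool" where
  "is_prox \<alpha> r x p \<longleftrightarrow>
     is_arg_min (\<lambda>y. ereal ((norm (x - y))\<^sup>2 / 2) + ereal \<alpha> * r y) (\<lambda>_. True) p"

definition Fmin :: "(real^'d \<Rightarrow> ereal) \<Rightarrow> ereal" where
  "Fmin F = (INF x. F x)"

definition solutions :: "(real^'d \<Rightarrow> ereal) \<Rightarrow> (real^'d) set" where
  "solutions F = {x. F x = Fmin F}"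

definition proj_sol :: "(real^'d \<Rightarrow> ereal) \<Rightarrow> real^'d \<Rightarrow> real^'d" where
  "proj_sol F x = closest_point (solutions F) x"

definition coercive :: "(real^'d \<Rightarrow> ereal) \<Rightarrow> bool" where
  "coercive F \<longleftrightarrow> (\<forall>X :: nat \<Rightarrow> real^'d.
     filterlim (\<lambda>k. norm (X k - proj_sol F (X k))) at_top sequentially \<longrightarrow>
     (\<lambda>k. F (X k)) \<longlonglongrightarrow> \<infinity>)"

text \<open>\<open>dF x\<close> is the subdifferential of \<open>F\<close> at \<open>x\<close>; as usual the infimum over the empty set is
  \<open>\<infinity>\<close>.\<close>

definition subdiff_coercive ::
  "(real^'d \<Rightarrow> ereal) \<Rightarrow> (real^'d \<Rightarrow> (real^'d) set) \<Rightarrow> bool" where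
  "subdiff_coercive F dF \<longleftrightarrow> (\<forall>X :: nat \<Rightarrow> real^'d.
     (\<lambda>k. F (X k)) \<longlonglongrightarrow> \<infinity> \<longrightarrow>
     (\<lambda>k. INF u\<in>dF (X k). ereal (norm u)) \<longlonglongrightarrow> \<infinity>)"

definition restricted_strongly_convex :: "(real^'d \<Rightarrow> ereal) \<Rightarrow> real \<Rightarrow> bool" where
  "restricted_strongly_convex F \<nu> \<longleftrightarrow>
     (\<forall>x. ereal (\<nu> / 2 * (norm (x - proj_sol F x))\<^sup>2) \<le> F x - Fmin F)"


subsection \<open>ZORO\<close>

text \<open>\<open>\<xi> k 0\<close> is the noise of the oracle call at \<open>x k\<close>, and \<open>\<xi> k (Suc i)\<close> that of the call
  at \<open>x k + \<delta> z\<^sub>i\<close>; the former call is made once per iteration, so that an iteration costs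
  \<open>m + 1\<close> queries.\<close>

definition finite_differences :: "(real^'d \<Rightarrow> real) \<Rightarrow> nat \<Rightarrow> real \<Rightarrow> (nat \<Rightarrow> real^'d) \<Rightarrow>
    (nat \<Rightarrow> real) \<Rightarrow> real^'d \<Rightarrow> nat \<Rightarrow> real" where
  "finite_differences f m \<delta> z \<zeta> x = (\<lambda>i. 1 / sqrt (real m) *
     (((f (x + \<delta> *\<^sub>R z i) + \<zeta> (Suc i)) - (f x + \<zeta> 0)) / \<delta>))"

definition zoro_run :: "(real^'d \<Rightarrow> real) \<Rightarrow> (real^'d \<Rightarrow> ereal) \<Rightarrow> nat \<Rightarrow> nat \<Rightarrow> nat \<Rightarrow> real \<Rightarrow> real \<Rightarrow>
    real^'d \<Rightarrow> (nat \<Rightarrow> real^'d) \<Rightarrow> (nat \<Rightarrow> nat \<Rightarrow> real) \<Rightarrow> (nat \<Rightarrow> real^'d) \<Rightarrow> bool" where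
  "zoro_run f r s m n \<alpha> \<delta> x0 z \<xi> x \<longleftrightarrow> x 0 = x0 \<and>
     (\<forall>k. \<exists>g. cosamp_output s m z (finite_differences f m \<delta> z (\<xi> k) (x k)) n g \<and>
              is_prox \<alpha> r (x k - \<alpha> *\<^sub>R g) (x (Suc k)))"

definition bounded_noise :: "real \<Rightarrow> (nat \<Rightarrow> nat \<Rightarrow> real) \<Rightarrow> bool" where
  "bounded_noise \<sigma> \<xi> \<longleftrightarrow> (\<forall>k i. \<bar>\<xi> k i\<bar> \<le> \<sigma>)"

text \<open>Queries come in blocks of \<open>m + 1\<close> per iteration, so the \<open>N\<close>-th query belongs to
  the iteration that produces \<open>x \<lceil>N / (m + 1)\<rceil>\<close>. If \<open>N \<le> 0\<close>, only \<open>x 0\<close> is available.\<close>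

definition eps_optimal_within ::
  "(real^'d \<Rightarrow> ereal) \<Rightarrow> nat \<Rightarrow> (nat \<Rightarrow> real^'d) \<Rightarrow> real \<Rightarrow> real \<Rightarrow> bool" where
  "eps_optimal_within F m x N \<epsilon> \<longleftrightarrow>
     (\<exists>k \<le> nat \<lceil>N / real (m + 1)\<rceil>. F (x k) - Fmin F \<le> ereal \<epsilon>)"

text \<open>An explicit admissible value of the compressed sensing constant \<open>b\<^sub>5\<close>. It is a multiple of the
  CoSaMP constant \<open>\<tau>\<close>: the gradient estimates have error at most \<open>3 \<tau> sqrt (\<sigma> H)\<close>. An existential
  quantifier instead would range below the type variable for the dimension, and could hide a
  dependence on \<open>d\<close>.\<close>

definition cs_const :: "real \<Rightarrow> real" where
  "cs_const \<tau> = 30 * \<tau>"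

text \<open>The positive part of \<open>ln e0\<close> is needed for \<open>e0 < 1\<close>: rescaling \<open>F\<close>, \<open>\<epsilon>\<close> and \<open>\<sigma>\<close> by the same
  small factor leaves the iterates and \<open>L * R\<^sup>2 / \<epsilon>\<close> unchanged but makes \<open>ln e0\<close> arbitrarily
  negative.\<close>

definition coercive_query_bound :: "real \<Rightarrow> nat \<Rightarrow> nat \<Rightarrow> real \<Rightarrow> real \<Rightarrow> real \<Rightarrow> real \<Rightarrow> real" where
  "coercive_query_bound b1 s d L e0 R \<epsilon> =
     b1 * real s * ln (real d) * (36 * L * R\<^sup>2 / \<epsilon> + max 0 (ln e0))"

definition strongly_convex_query_bound ::
  "real \<Rightarrow> real \<Rightarrow> nat \<Rightarrow> nat \<Rightarrow> real \<Rightarrow> real \<Rightarrow> real \<Rightarrow> real \<Rightarrow> real \<Rightarrow> real \<Rightarrow> real" where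
  "strongly_convex_query_bound b1 b5 s d L \<nu> H e0 \<sigma> \<epsilon> =
     b1 * real s * ln (real d) * ln ((\<epsilon> * \<nu> - b5\<^sup>2 * \<sigma> * H) / (\<nu> * e0))
       / (ln (24 * L) - ln (\<nu> + 24 * L))"

end

theory Submission
  imports Defs
begin

text \<open>
  ZORO is a proximal gradient method with inexact gradients, so the proof has three layers.

  \<^emph>\<open>Gradient estimates.\<close> Along a sign vector \<open>z\<close> the second derivative of \<open>f\<close> is at most the
  entry-wise norm \<open>H\<close> of the Hessian. With query radius \<open>\<delta>\<close> a difference quotient therefore misses
  \<open>\<nabla>f(x) \<bullet> z\<close> by at most \<open>\<delta> H / 2 + 2 \<sigma> / \<delta>\<close>, and \<open>\<delta> = 2 sqrt (\<sigma> / H)\<close> makes both terms equal to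
  \<open>sqrt (\<sigma> H)\<close>. Since the gradient is \<open>s\<close>-sparse, the CoSaMP guarantee leaves the error
  \<open>\<eta> = 3 \<tau> sqrt (\<sigma> H)\<close> (\<open>cosamp_gradient_error\<close>). Only here does randomness enter: everything else
  is deterministic on the event that the measurement matrix is good.

  \<^emph>\<open>One step.\<close> Let \<open>e, e'\<close> be the gaps \<open>F - min F\<close> before and after a step, and let \<open>D, D'\<close> be the
  distances to the solution set. Two inequalities carry the rates. Comparing with the point a
  fraction \<open>t\<close> of the way to the nearest solution gives
  \<open>e' \<le> (1 - t) e + L t\<^sup>2 D\<^sup>2 / 2 + \<eta>\<^sup>2 / (2 L)\<close> (\<open>step_towards_solution\<close>). Since \<open>\<nabla>f\<close> is constant on
  the solution set, also \<open>e' \<le> (2 L D + \<eta>) D'\<close> (\<open>step_gap_le_distances\<close>). The second one is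
  indispensable where the first is weak: for \<open>\<epsilon>\<close> much larger than \<open>L R\<^sup>2\<close> its noise term \<open>\<eta>\<^sup>2 / (2 L)\<close>
  may exceed \<open>\<epsilon>\<close>, and for \<open>\<nu>\<close> much larger than \<open>L\<close> neither its noise term nor its contraction
  suffices.

  \<^emph>\<open>Rates.\<close> In the coercive case, one step brings the gap down to \<open>2 L R\<^sup>2 + \<epsilon> / 10\<close>, whatever \<open>e0\<close> is;
  after that \<open>t\<close> proportional to \<open>e / (L R\<^sup>2)\<close> yields \<open>e' \<le> e - e\<^sup>2 / (5 L R\<^sup>2)\<close> as long as \<open>e > \<epsilon>\<close>,
  hence \<open>k e\<^sub>k \<le> 5 L R\<^sup>2\<close> (\<open>sublinear_rate\<close>). Under restricted strong convexity both inequalities turn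
  into a contraction by \<open>(24 L / (\<nu> + 24 L))\<^sup>2\<close> towards \<open>100 \<eta>\<^sup>2 / \<nu>\<close> (\<open>strongly_convex_step\<close>). An
  iteration takes \<open>m + 1 \<le> 2 m\<close> queries, so that the query budget pays for at least half of the
  iterations that its formula suggests; the constants leave room for this factor.

  The iterates stay bounded because a step can increase \<open>F\<close> only if its length is at most \<open>2 \<eta> / L\<close>,
  and then \<open>F\<close> has a subgradient of norm at most \<open>5 \<eta>\<close> at the new point; coercivity of the
  subdifferential bounds \<open>F\<close> at such points (\<open>iterates_bounded\<close>).
\<close>

section \<open>Smooth convex functions\<close>

lemma has_real_derivative_along_line:
  fixes f :: "real^'d \<Rightarrow> real"
  assumes "\<And>x. GDERIV f x :> grad x"
  shows "((\<lambda>t. f (x + t *\<^sub>R h)) has_real_derivative (grad (x + t *\<^sub>R h) \<bullet> h)) (at t)"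
proof -
  have "(f has_derivative (\<lambda>k. k \<bullet> grad (x + t *\<^sub>R h))) (at (x + t *\<^sub>R h))"
    using assms by (simp add: gderiv_def)
  moreover have "((\<lambda>t. x + t *\<^sub>R h) has_derivative (\<lambda>u. u *\<^sub>R h)) (at t)"
    by (auto intro!: derivative_eq_intros)
  ultimately have "((\<lambda>t. f (x + t *\<^sub>R h)) has_derivative
      (\<lambda>u. (u *\<^sub>R h) \<bullet> grad (x + t *\<^sub>R h))) (at t)"
    by (rule has_derivative_compose[rotated])
  then show ?thesis
    by (rule has_derivative_imp_has_field_derivative) (simp add: inner_commute)
qed

lemma convex_above_tangent:
  fixes f :: "real^'d \<Rightarrow> real"
  assumes "convex_on UNIV f" and grad: "\<And>x. GDERIV f x :> grad x"
  shows "f x + grad x \<bullet> (y - x) \<le> f y"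
proof -
  define \<phi> where "\<phi> = (\<lambda>t. f (x + t *\<^sub>R (y - x)))"
  have "convex_on UNIV \<phi>"
  proof (rule convex_onI)
    fix t a b :: real assume t: "0 < t" "t < 1"
    have "x + ((1 - t) *\<^sub>R a + t *\<^sub>R b) *\<^sub>R (y - x)
        = (1 - t) *\<^sub>R (x + a *\<^sub>R (y - x)) + t *\<^sub>R (x + b *\<^sub>R (y - x))"
      by (simp add: algebra_simps)
    then show "\<phi> ((1 - t) *\<^sub>R a + t *\<^sub>R b) \<le> (1 - t) * \<phi> a + t * \<phi> b"
      unfolding \<phi>_def using convex_onD[OF assms(1), of t] t by simp
  qed simp
  moreover have "(\<phi> has_real_derivative grad x \<bullet> (y - x)) (at 0 within UNIV)"
    using has_real_derivative_along_line[OF grad, of x "y - x" 0] by (simp add: \<phi>_def)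
  ultimately have "\<phi> 1 - \<phi> 0 \<ge> (grad x \<bullet> (y - x)) * (1 - 0)"
    by (intro convex_on_imp_above_tangent[where A = UNIV]) auto
  then show ?thesis by (simp add: \<phi>_def)
qed

lemma smooth_below_quadratic:
  fixes f :: "real^'d \<Rightarrow> real"
  assumes grad: "\<And>x. GDERIV f x :> grad x"
    and lip: "\<And>x y. norm (grad x - grad y) \<le> L * norm (x - y)"
  shows "f y \<le> f x + grad x \<bullet> (y - x) + L / 2 * (norm (y - x))\<^sup>2"
proof -
  let ?h = "y - x"
  let ?g = "\<lambda>t. f (x + t *\<^sub>R ?h) - t * (grad x \<bullet> ?h) - L / 2 * t\<^sup>2 * (norm ?h)\<^sup>2"
  have "?g 1 \<le> ?g 0"
  proof (rule DERIV_nonpos_imp_nonincreasing[OF zero_le_one])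
    fix t :: real assume t: "0 \<le> t" "t \<le> 1"
    let ?D = "grad (x + t *\<^sub>R ?h) \<bullet> ?h - grad x \<bullet> ?h - L * t * (norm ?h)\<^sup>2"
    have "(?g has_real_derivative ?D) (at t)"
      by (rule derivative_eq_intros has_real_derivative_along_line[OF grad] refl)+ simp
    moreover have "?D \<le> 0"
    proof -
      have "(grad (x + t *\<^sub>R ?h) - grad x) \<bullet> ?h \<le> norm (grad (x + t *\<^sub>R ?h) - grad x) * norm ?h"
        by (rule norm_cauchy_schwarz)
      also have "\<dots> \<le> (L * norm (t *\<^sub>R ?h)) * norm ?h"
        using lip[of "x + t *\<^sub>R ?h" x] by (intro mult_right_mono) auto
      finally show ?thesis using t by (simp add: inner_diff_left power2_eq_square)
    qed
    ultimately show "\<exists>D. (?g has_real_derivative D) (at t) \<and> D \<le> 0" by blast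
  qed
  then show ?thesis by simp
qed

section \<open>Gradient estimates from noisy function values\<close>

text \<open>Sign vectors have all entries of modulus one, so the entry-wise norm bounds the curvature along
  them without any factor depending on the dimension.\<close>

lemma abs_quadratic_form_le_entrywise_l1:
  fixes A :: "real^'d^'d"
  assumes "\<And>j. v $ j \<in> {-1, 1}"
  shows "\<bar>(A *v v) \<bullet> v\<bar> \<le> entrywise_l1 A"
proof -
  have "\<bar>v $ j\<bar> = 1" for j using assms[of j] by auto
  moreover have "(A *v v) \<bullet> v = (\<Sum>i\<in>UNIV. \<Sum>j\<in>UNIV. A $ i $ j * v $ j * v $ i)"
    by (simp add: inner_vec_def matrix_vector_mult_def sum_distrib_right)
  then have "\<bar>(A *v v) \<bullet> v\<bar> \<le> (\<Sum>i\<in>UNIV. \<Sum>j\<in>UNIV. \<bar>A $ i $ j * v $ j * v $ i\<bar>)"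
    by (simp add: order.trans[OF sum_abs] sum_mono)
  ultimately show ?thesis by (simp add: entrywise_l1_def abs_mult)
qed

lemma directional_taylor_error:
  fixes f :: "real^'d \<Rightarrow> real"
  assumes grad: "\<And>x. GDERIV f x :> grad x"
    and hess: "\<And>x. (grad has_derivative (\<lambda>h. hess x *v h)) (at x)"
    and H: "\<And>x. entrywise_l1 (hess x) \<le> H"
    and v: "\<And>j. v $ j \<in> {-1, 1}" and "0 < \<delta>"
  shows "\<bar>f (x + \<delta> *\<^sub>R v) - f x - \<delta> * (grad x \<bullet> v)\<bar> \<le> H * \<delta>\<^sup>2 / 2"
proof -
  \<comment> \<open>The restriction of \<open>f\<close> to the line and its first two derivatives, indexed by the order.\<close>
  define diff where "diff = (\<lambda>(k::nat) t. if k = 0 then f (x + t *\<^sub>R v)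
    else if k = Suc 0 then grad (x + t *\<^sub>R v) \<bullet> v
    else (hess (x + t *\<^sub>R v) *v v) \<bullet> v)"
  have D0: "(diff 0 has_real_derivative diff (Suc 0) t) (at t)" for t
    unfolding diff_def using has_real_derivative_along_line[OF grad] by simp
  have D1: "(diff (Suc 0) has_real_derivative diff (Suc (Suc 0)) t) (at t)" for t
  proof -
    have "((\<lambda>t. x + t *\<^sub>R v) has_derivative (\<lambda>u. u *\<^sub>R v)) (at t)"
      by (auto intro!: derivative_eq_intros)
    from has_derivative_compose[OF this hess]
    have "((\<lambda>t. grad (x + t *\<^sub>R v)) has_derivative (\<lambda>u. hess (x + t *\<^sub>R v) *v (u *\<^sub>R v))) (at t)" .
    then have "((\<lambda>t. grad (x + t *\<^sub>R v) \<bullet> v) has_derivative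
        (\<lambda>u. (hess (x + t *\<^sub>R v) *v (u *\<^sub>R v)) \<bullet> v)) (at t)"
      by (rule has_derivative_inner_left)
    then have "((\<lambda>t. grad (x + t *\<^sub>R v) \<bullet> v) has_real_derivative
        (hess (x + t *\<^sub>R v) *v v) \<bullet> v) (at t)"
      by (rule has_derivative_imp_has_field_derivative)
        (simp add: matrix_vector_mult_scaleR)
    then show ?thesis by (simp add: diff_def)
  qed
  have "\<exists>t. 0 < t \<and> t < \<delta> \<and> diff 0 \<delta> =
      (\<Sum>k<Suc (Suc 0). diff k 0 / fact k * \<delta> ^ k) + diff (Suc (Suc 0)) t / fact (Suc (Suc 0)) * \<delta> ^ Suc (Suc 0)"
    using D0 D1 \<open>0 < \<delta>\<close> by (intro Maclaurin) (auto simp: less_Suc_eq)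
  then obtain t where t: "f (x + \<delta> *\<^sub>R v) - f x - \<delta> * (grad x \<bullet> v)
      = ((hess (x + t *\<^sub>R v) *v v) \<bullet> v) * \<delta>\<^sup>2 / 2"
    by (auto simp: diff_def power2_eq_square)
  have "\<bar>(hess (x + t *\<^sub>R v) *v v) \<bullet> v\<bar> \<le> H"
    using abs_quadratic_form_le_entrywise_l1[OF v] H order.trans by blast
  then show ?thesis
    unfolding t by (simp add: abs_mult mult_right_mono)
qed

text \<open>Each entry has a Taylor error of at most \<open>\<delta> H / 2\<close> and a noise error of at most \<open>2 \<sigma> / \<delta>\<close>; this \<open>\<delta>\<close>
  balances them. The factor \<open>1 / sqrt m\<close> in the rows makes the Euclidean norm independent of \<open>m\<close>.\<close>

lemma finite_differences_error:
  fixes f :: "real^'d \<Rightarrow> real" and \<zeta> :: "nat \<Rightarrow> real"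
  assumes grad: "\<And>x. GDERIV f x :> grad x"
    and hess: "\<And>x. (grad has_derivative (\<lambda>h. hess x *v h)) (at x)"
    and H: "\<And>x. entrywise_l1 (hess x) \<le> H" "0 < H"
    and signs: "\<And>i j. i < m \<Longrightarrow> z i $ j \<in> {-1, 1}"
    and "0 < \<sigma>" and noise: "\<And>i. \<bar>\<zeta> i\<bar> \<le> \<sigma>"
  defines "\<delta> \<equiv> 2 * sqrt (\<sigma> / H)"
  shows "L2_set (\<lambda>i. finite_differences f m \<delta> z \<zeta> x i - Z_mult m z (grad x) i) {..<m}
      \<le> 2 * sqrt (\<sigma> * H)"
    (is "L2_set ?e _ \<le> ?c")
proof -
  have "0 < \<delta>" using assms by (simp add: \<delta>_def)
  have \<delta>H: "\<delta> * H = ?c"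
  proof -
    have "sqrt (\<sigma> / H) * H = sqrt (\<sigma> * H)"
      using H(2) by (simp add: real_sqrt_divide real_sqrt_mult field_simps)
    then show ?thesis by (simp add: \<delta>_def)
  qed
  have \<sigma>\<delta>: "2 * \<sigma> = \<delta> * (?c / 2)"
  proof -
    have "sqrt (\<sigma> / H) * sqrt (\<sigma> * H) = \<sigma>"
      using H(2) \<open>0 < \<sigma>\<close> by (simp flip: real_sqrt_mult)
    then show ?thesis by (simp add: \<delta>_def)
  qed
  have rearrange: "1 / w * ((a + u - (b + v)) / \<delta>) - c / w = (a - b - \<delta> * c + (u - v)) / \<delta> / w"
    for a b c u v w :: real
    using \<open>0 < \<delta>\<close> by (cases "w = 0") (auto simp: field_simps)
  have e: "\<bar>?e i\<bar> \<le> ?c / sqrt (real m)" if "i < m" for i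
  proof -
    let ?T = "f (x + \<delta> *\<^sub>R z i) - f x - \<delta> * (grad x \<bullet> z i)"
    have "\<bar>?T + (\<zeta> (Suc i) - \<zeta> 0)\<bar> \<le> \<bar>?T\<bar> + (\<bar>\<zeta> (Suc i)\<bar> + \<bar>\<zeta> 0\<bar>)" by linarith
    also have "\<dots> \<le> H * \<delta>\<^sup>2 / 2 + (\<sigma> + \<sigma>)"
      using directional_taylor_error[OF grad hess H(1) signs[OF that] \<open>0 < \<delta>\<close>] noise
      by (intro add_mono)
    also have "\<dots> = \<delta> * ((\<delta> * H) / 2) + 2 * \<sigma>" by (simp add: power2_eq_square)
    also have "\<dots> = \<delta> * ?c" unfolding \<delta>H \<sigma>\<delta> by simp
    finally have "\<bar>?T + (\<zeta> (Suc i) - \<zeta> 0)\<bar> / \<delta> \<le> ?c"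
      using \<open>0 < \<delta>\<close> by (simp add: field_simps)
    then have "\<bar>?T + (\<zeta> (Suc i) - \<zeta> 0)\<bar> / \<delta> / sqrt (real m) \<le> ?c / sqrt (real m)"
      by (rule divide_right_mono) simp
    moreover have "?e i = ((?T + (\<zeta> (Suc i) - \<zeta> 0)) / \<delta>) / sqrt (real m)"
      by (simp only: finite_differences_def Z_mult_def inner_commute[of "z i"] rearrange)
    ultimately show ?thesis
      using \<open>0 < \<delta>\<close> by simp
  qed
  have "L2_set ?e {..<m} \<le> L2_set (\<lambda>_. ?c / sqrt (real m)) {..<m}"
    unfolding L2_set_def
  proof (intro real_sqrt_le_mono sum_mono)
    fix i assume "i \<in> {..<m}"
    then have "\<bar>?e i\<bar> \<le> \<bar>?c / sqrt (real m)\<bar>"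
      using e[of i] by (meson abs_ge_self lessThan_iff order.trans)
    then show "(?e i)\<^sup>2 \<le> (?c / sqrt (real m))\<^sup>2"
      by (simp only: abs_le_square_iff)
  qed
  also have "\<dots> \<le> ?c"
    using assms(4,6) by (cases "m = 0") (simp_all add: L2_set_def power_divide power_mult_distrib real_sqrt_mult)
  finally show ?thesis .
qed

text \<open>A sparse gradient is its own best sparse approximation, so that only the measurement error and the
  truncation of the CoSaMP iteration remain: \<open>2 \<tau> sqrt (\<sigma> H)\<close> from the former and \<open>\<tau> sqrt (\<sigma> H)\<close>
  from the latter.\<close>

lemma cosamp_gradient_error:
  fixes f :: "real^'d \<Rightarrow> real" and \<zeta> :: "nat \<Rightarrow> real"
  assumes grad: "\<And>x. GDERIV f x :> grad x"
    and hess: "\<And>x. (grad has_derivative (\<lambda>h. hess x *v h)) (at x)"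
    and H: "\<And>x. entrywise_l1 (hess x) \<le> H" "0 < H"
    and signs: "\<And>i j. i < m \<Longrightarrow> z i $ j \<in> {-1, 1}"
    and \<sigma>: "0 < \<sigma>" and noise: "\<And>i. \<bar>\<zeta> i\<bar> \<le> \<sigma>"
    and sparse: "l0_norm (grad x) \<le> s"
    and guarantee: "cosamp_guarantee TYPE('d) s m \<rho> \<tau>" and "0 < \<tau>"
    and good: "good_matrix s m z"
    and out: "cosamp_output s m z (finite_differences f m (2 * sqrt (\<sigma> / H)) z \<zeta> x) n g"
    and n: "\<rho> ^ n * norm (grad x) \<le> \<tau> * sqrt (\<sigma> * H)"
  shows "norm (g - grad x) \<le> 3 * \<tau> * sqrt (\<sigma> * H)"
proof -
  define e where "e = (\<lambda>i. finite_differences f m (2 * sqrt (\<sigma> / H)) z \<zeta> x i - Z_mult m z (grad x) i)"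
  have "best_sparse s (grad x) (grad x)"
    using sparse by (simp add: best_sparse_def is_arg_min_def)
  moreover have "cosamp_output s m z (\<lambda>i. Z_mult m z (grad x) i + e i) n g"
    using out by (simp add: e_def)
  ultimately have "norm (g - grad x) \<le> norm (grad x - grad x)
      + \<tau> * L2_set (Z_mult m z (grad x - grad x)) {..<m}
      + \<tau> * L2_set e {..<m} + \<rho> ^ n * norm (grad x)"
    using guarantee good unfolding cosamp_guarantee_def by blast
  also have "\<dots> = \<tau> * L2_set e {..<m} + \<rho> ^ n * norm (grad x)"
    by (simp add: Z_mult_def L2_set_def)
  also have "\<dots> \<le> \<tau> * (2 * sqrt (\<sigma> * H)) + \<tau> * sqrt (\<sigma> * H)"
    using finite_differences_error[OF grad hess H signs \<sigma> noise] \<open>0 < \<tau>\<close> n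
    unfolding e_def by (intro add_mono mult_left_mono) auto
  finally show ?thesis by simp
qed

section \<open>The random measurement matrix\<close>

lemma set_pmf_rademacher_vector:
  "set_pmf (rademacher_vector :: (real^'d) pmf) = {v. \<forall>j. v $ j \<in> {-1, 1}}"
proof -
  have "{v :: real^'d. \<forall>j. v $ j \<in> {-1, 1}} = vec_lambda ` (\<Pi>\<^sub>E j\<in>UNIV. {-1, 1})"
  proof (intro equalityI subsetI)
    fix v :: "real^'d" assume "v \<in> {v. \<forall>j. v $ j \<in> {-1, 1}}"
    then have "vec_nth v \<in> (\<Pi>\<^sub>E j\<in>UNIV. {-1, 1})" "v = vec_lambda (vec_nth v)" by auto
    then show "v \<in> vec_lambda ` (\<Pi>\<^sub>E j\<in>UNIV. {-1, 1})" by blast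
  qed (auto simp: PiE_iff)
  then have "finite {v :: real^'d. \<forall>j. v $ j \<in> {-1, 1}}"
    by (simp add: finite_PiE)
  moreover have "(\<chi> j. 1) \<in> {v :: real^'d. \<forall>j. v $ j \<in> {-1, 1}}" by simp
  ultimately show ?thesis unfolding rademacher_vector_def by (intro set_pmf_of_set) blast+
qed

lemma rademacher_family_signs:
  assumes "z \<in> set_pmf (rademacher_family m :: (nat \<Rightarrow> real^'d) pmf)" and "i < m"
  shows "z i $ j \<in> {-1, 1}"
proof -
  have "z i \<in> set_pmf (rademacher_vector :: (real^'d) pmf)"
    using assms by (auto simp: rademacher_family_def set_Pi_pmf PiE_dflt_def)
  then show ?thesis by (simp add: set_pmf_rademacher_vector)
qed

text \<open>Without rows every vector is mapped to zero, which contradicts the lower bound of the RIP.\<close>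

lemma good_matrix_rows_pos:
  fixes z :: "nat \<Rightarrow> real^'d"
  assumes "good_matrix s m z" and "0 < s"
  shows "0 < m"
proof (rule ccontr)
  assume "\<not> 0 < m"
  obtain c where c: "RIP (4 * s) c m z" using assms(1) by (auto simp: good_matrix_def)
  fix i :: 'd
  have "supp (axis i 1 :: real^'d) = {i}" by (auto simp: supp_def axis_def)
  then have "l0_norm (axis i 1 :: real^'d) \<le> 4 * s" using assms(2) by (simp add: l0_norm_def)
  then have "(1 - c) * (norm (axis i 1 :: real^'d))\<^sup>2 \<le> (L2_set (Z_mult m z (axis i 1)) {..<m})\<^sup>2"
    using c by (auto simp: RIP_def)
  with \<open>\<not> 0 < m\<close> have "1 - c \<le> 0" by simp
  with c show False by (simp add: RIP_def)
qed

text \<open>The support matters because the measurement vectors are sign vectors only there.\<close>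

lemma prob_ge_if_suffices_on_support:
  assumes "p \<le> measure_pmf.prob M {z. Q z}" and "\<And>z. z \<in> set_pmf M \<Longrightarrow> Q z \<Longrightarrow> z \<in> E"
  shows "p \<le> measure_pmf.prob M E"
proof -
  have "measure_pmf.prob M {z. Q z} = measure_pmf.prob M ({z. Q z} \<inter> set_pmf M)"
    by (simp add: measure_Int_set_pmf)
  also have "\<dots> \<le> measure_pmf.prob M E"
    using assms(2) by (intro measure_pmf.finite_measure_mono) auto
  finally show ?thesis using assms(1) by simp
qed

section \<open>Convex composite objectives\<close>

lemma nonpos_if_le_small_multiples:
  fixes a c :: real
  assumes "\<And>t. 0 < t \<Longrightarrow> t < 1 \<Longrightarrow> a \<le> t * c"
  shows "a \<le> 0"
proof (rule tendsto_lowerbound)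
  show "((\<lambda>t. t * c) \<longlongrightarrow> 0) (at_right 0)"
    by (rule tendsto_eq_intros refl)+ simp
  show "\<forall>\<^sub>F t in at_right 0. a \<le> t * c"
    using eventually_at_right_real[of 0 1] by (rule eventually_mono) (auto intro: assms)
qed simp

lemma inner_le_norm_bound:
  fixes a b :: "real^'d"
  assumes "norm a \<le> \<eta>" shows "a \<bullet> b \<le> \<eta> * norm b"
  using norm_cauchy_schwarz[of a b] mult_right_mono[OF assms norm_ge_zero[of b]] by linarith

text \<open>
  Solvability of all proximal problems takes the place of lower semicontinuity of \<open>r\<close>: it is what
  makes the solution set closed, so that nearest solutions exist.
\<close>

locale composite =
  fixes f :: "real^'d \<Rightarrow> real" and grad :: "real^'d \<Rightarrow> real^'d"
    and r F :: "real^'d \<Rightarrow> ereal" and L :: real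
  assumes f_convex: "convex_on UNIV f"
    and gradient: "\<And>x. GDERIV f x :> grad x"
    and L_pos: "0 < L" and lipschitz: "\<And>x y. norm (grad x - grad y) \<le> L * norm (x - y)"
    and r_convex: "convex_ereal r" and r_not_MInf: "\<And>x. r x \<noteq> -\<infinity>"
    and F: "F = (\<lambda>x. ereal (f x) + r x)"
    and solution_exists: "solutions F \<noteq> {}"
    and finite_value: "\<exists>x. F x < \<infinity>"
    and prox_exists: "\<And>v. \<exists>q. is_prox (1 / L) r v q"
begin

definition dom :: "(real^'d) set" where
  "dom = {x. r x < \<infinity>}"

text \<open>The real value of \<open>r\<close>; meaningful on \<open>dom\<close> only, and likewise \<open>gap\<close> below.\<close>

definition rv :: "real^'d \<Rightarrow> real" where
  "rv x = real_of_ereal (r x)"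

definition Fopt :: real where
  "Fopt = real_of_ereal (Fmin F)"

definition gap :: "real^'d \<Rightarrow> real" where
  "gap x = f x + rv x - Fopt"

definition P :: "real^'d \<Rightarrow> real^'d" where
  "P = proj_sol F"

text \<open>A proximal gradient step with step size \<open>1 / L\<close> and a gradient estimate of error at most \<open>\<eta>\<close>,
  in terms of the optimality condition of the proximal problem rather than of its minimizer.\<close>

definition inexact_step :: "real \<Rightarrow> real^'d \<Rightarrow> real^'d \<Rightarrow> bool" where
  "inexact_step \<eta> x x' \<longleftrightarrow>
     (\<exists>g. norm (g - grad x) \<le> \<eta> \<and> L *\<^sub>R (x - x') - g \<in> subdifferential r x')"

lemma r_on_dom: "x \<in> dom \<Longrightarrow> r x = ereal (rv x)"
  using r_not_MInf[of x] by (cases "r x") (auto simp: dom_def rv_def)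

lemma r_off_dom: "x \<notin> dom \<Longrightarrow> r x = \<infinity>"
  by (auto simp: dom_def)

lemma F_on_dom: "x \<in> dom \<Longrightarrow> F x = ereal (f x + rv x)"
  by (simp add: F r_on_dom)

lemma in_dom_iff: "x \<in> dom \<longleftrightarrow> F x < \<infinity>"
  by (cases "r x") (auto simp: dom_def F)

lemma dom_nonempty: "dom \<noteq> {}"
  using finite_value by (auto simp: in_dom_iff)

lemma Fmin_eq: "Fmin F = ereal Fopt"
proof -
  obtain xs where xs: "F xs = Fmin F"
    using solution_exists by (auto simp: solutions_def)
  obtain y where y: "F y < \<infinity>" using finite_value by blast
  have "Fmin F \<le> F y" unfolding Fmin_def by (rule INF_lower) simp
  with y xs have "xs \<in> dom" by (auto simp: in_dom_iff)
  with xs show ?thesis by (metis F_on_dom Fopt_def real_of_ereal.simps(1))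
qed

lemma gap_nonneg: "x \<in> dom \<Longrightarrow> 0 \<le> gap x"
proof -
  assume "x \<in> dom"
  moreover have "Fmin F \<le> F x" unfolding Fmin_def by (rule INF_lower) simp
  ultimately show ?thesis by (simp add: Fmin_eq F_on_dom gap_def)
qed

lemma F_minus_Fmin: "x \<in> dom \<Longrightarrow> F x - Fmin F = ereal (gap x)"
  by (simp add: F_on_dom Fmin_eq gap_def)

lemma solutions_iff: "x \<in> solutions F \<longleftrightarrow> x \<in> dom \<and> gap x = 0"
proof (cases "x \<in> dom")
  case False
  then show ?thesis using Fmin_eq by (auto simp: solutions_def in_dom_iff)
qed (auto simp: solutions_def Fmin_eq F_on_dom gap_def)

lemma rv_convex:
  assumes "x \<in> dom" "y \<in> dom" "0 \<le> t" "t \<le> 1"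
  shows "x + t *\<^sub>R (y - x) \<in> dom"
    and "rv (x + t *\<^sub>R (y - x)) \<le> (1 - t) * rv x + t * rv y"
proof -
  let ?z = "(1 - t) *\<^sub>R x + t *\<^sub>R y"
  have z: "x + t *\<^sub>R (y - x) = ?z" by (simp add: algebra_simps)
  have "r ?z \<le> ereal (1 - t) * r x + ereal t * r y"
    using r_convex assms(3,4) by (auto simp: convex_ereal_def)
  also have "\<dots> = ereal ((1 - t) * rv x + t * rv y)"
    using assms(1,2) by (simp add: r_on_dom)
  finally have le: "r ?z \<le> ereal ((1 - t) * rv x + t * rv y)" .
  then show "x + t *\<^sub>R (y - x) \<in> dom" unfolding z dom_def by auto
  with le show "rv (x + t *\<^sub>R (y - x)) \<le> (1 - t) * rv x + t * rv y"
    unfolding z by (simp add: r_on_dom)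
qed

lemma gap_convex:
  assumes "x \<in> dom" "y \<in> dom" "0 \<le> t" "t \<le> 1"
  shows "gap (x + t *\<^sub>R (y - x)) \<le> (1 - t) * gap x + t * gap y"
proof -
  have "f (x + t *\<^sub>R (y - x)) \<le> (1 - t) * f x + t * f y"
    using convex_onD[OF f_convex, of t x y] assms(3,4) by (simp add: algebra_simps)
  with rv_convex(2)[OF assms] show ?thesis by (simp add: gap_def algebra_simps)
qed

lemma subgradient:
  assumes "u \<in> subdifferential r x"
  shows "x \<in> dom" and "y \<in> dom \<Longrightarrow> rv x + u \<bullet> (y - x) \<le> rv y"
proof -
  have le: "r x + ereal (u \<bullet> (y - x)) \<le> r y" for y
    using assms by (simp add: subdifferential_def)
  obtain z where z: "z \<in> dom" using dom_nonempty by blast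
  show x: "x \<in> dom"
    using le[of z] r_on_dom[OF z] by (cases "r x") (auto simp: dom_def)
  show "rv x + u \<bullet> (y - x) \<le> rv y" if "y \<in> dom"
    using le[of y] x that by (simp add: r_on_dom)
qed

text \<open>Compare \<open>p\<close> with the points at fraction \<open>t\<close> of the segment from \<open>p\<close> to \<open>y\<close>: the quadratic term
  contributes its first-order part and a term in \<open>t\<^sup>2\<close>, which disappears as \<open>t\<close> tends to zero.\<close>

lemma prox_subgradient:
  assumes "is_prox \<alpha> r v p" and "0 < \<alpha>"
  shows "(1 / \<alpha>) *\<^sub>R (v - p) \<in> subdifferential r p"
proof -
  have le: "ereal ((norm (v - p))\<^sup>2 / 2) + ereal \<alpha> * r p
      \<le> ereal ((norm (v - y))\<^sup>2 / 2) + ereal \<alpha> * r y" for y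
    using assms(1) by (auto simp: is_prox_def is_arg_min_def not_less)
  obtain z where z: "z \<in> dom" using dom_nonempty by blast
  have p: "p \<in> dom"
    using le[of z] r_on_dom[OF z] r_not_MInf[of p] \<open>0 < \<alpha>\<close>
    by (cases "r p") (auto simp: dom_def)
  have "rv p + ((1 / \<alpha>) *\<^sub>R (v - p)) \<bullet> (y - p) \<le> rv y" if y: "y \<in> dom" for y
  proof -
    have "(v - p) \<bullet> (y - p) + \<alpha> * (rv p - rv y) \<le> t * ((norm (y - p))\<^sup>2 / 2)"
      if t: "0 < t" "t < 1" for t
    proof -
      let ?z = "p + t *\<^sub>R (y - p)"
      have z: "?z \<in> dom" "rv ?z \<le> (1 - t) * rv p + t * rv y"
        using rv_convex[OF p y] t by auto
      have "(norm (v - p))\<^sup>2 / 2 + \<alpha> * rv p \<le> (norm (v - ?z))\<^sup>2 / 2 + \<alpha> * rv ?z"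
        using le[of ?z] p z(1) by (simp add: r_on_dom)
      also have "\<dots> \<le> (norm (v - ?z))\<^sup>2 / 2 + \<alpha> * ((1 - t) * rv p + t * rv y)"
        using z(2) \<open>0 < \<alpha>\<close> by simp
      also have "(norm (v - ?z))\<^sup>2 = (norm (v - p))\<^sup>2 - 2 * t * ((v - p) \<bullet> (y - p)) + t\<^sup>2 * (norm (y - p))\<^sup>2"
        unfolding power2_norm_eq_inner
        by (simp add: inner_simps inner_commute power2_eq_square algebra_simps)
      finally have "t * ((v - p) \<bullet> (y - p) + \<alpha> * (rv p - rv y)) \<le> t * (t * ((norm (y - p))\<^sup>2 / 2))"
        by (simp add: field_simps power2_eq_square)
      with t show ?thesis by simp
    qed
    then have "(v - p) \<bullet> (y - p) + \<alpha> * (rv p - rv y) \<le> 0"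
      by (rule nonpos_if_le_small_multiples)
    with \<open>0 < \<alpha>\<close> have "rv p + ((v - p) \<bullet> (y - p)) / \<alpha> \<le> rv y"
      by (simp add: field_simps)
    then show ?thesis by simp
  qed
  then show ?thesis
    unfolding subdifferential_def using p
    by (auto simp: r_on_dom) (metis r_on_dom r_off_dom ereal_less_eq(1,3))
qed

section \<open>Inexact proximal gradient steps\<close>

lemma inexact_step_prox:
  assumes "is_prox (1 / L) r (x - (1 / L) *\<^sub>R g) x'" and "norm (g - grad x) \<le> \<eta>"
  shows "inexact_step \<eta> x x'"
proof -
  have "L *\<^sub>R (x - (1 / L) *\<^sub>R g - x') = L *\<^sub>R (x - x') - g"
    using L_pos by (simp add: algebra_simps)
  then have "L *\<^sub>R (x - x') - g \<in> subdifferential r x'"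
    using prox_subgradient[OF assms(1)] L_pos by simp
  with assms(2) show ?thesis unfolding inexact_step_def by blast
qed

lemma inexact_step_dom: "inexact_step \<eta> x x' \<Longrightarrow> x' \<in> dom"
  unfolding inexact_step_def using subgradient(1) by blast

text \<open>The quadratic upper bound of \<open>f\<close> at \<open>x\<close>, its linear lower bound, and the subgradient inequality for
  \<open>r\<close> at \<open>x'\<close> add up; the scalar products combine to the difference of squares by the cosine rule.\<close>

lemma step_bound:
  assumes "inexact_step \<eta> x x'" and y: "y \<in> dom"
  shows "gap x' \<le> gap y + L / 2 * (norm (y - x))\<^sup>2 - L / 2 * (norm (y - x'))\<^sup>2 + \<eta> * norm (x' - y)"
proof -
  obtain g where g: "norm (grad x - g) \<le> \<eta>"
    and sub: "L *\<^sub>R (x - x') - g \<in> subdifferential r x'"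
    using assms(1) by (auto simp: inexact_step_def norm_minus_commute)
  have "rv x' + (L *\<^sub>R (x - x') - g) \<bullet> (y - x') \<le> rv y"
    using subgradient(2)[OF sub y] .
  moreover have "f x' \<le> f x + grad x \<bullet> (x' - x) + L / 2 * (norm (x' - x))\<^sup>2"
    by (rule smooth_below_quadratic[OF gradient lipschitz])
  moreover have "f x + grad x \<bullet> (y - x) \<le> f y"
    by (rule convex_above_tangent[OF f_convex gradient])
  moreover have "(grad x - g) \<bullet> (x' - y) \<le> \<eta> * norm (x' - y)"
    by (rule inner_le_norm_bound[OF g])
  moreover have "(norm (x' - x))\<^sup>2 - 2 * ((x - x') \<bullet> (y - x')) = (norm (y - x))\<^sup>2 - (norm (y - x'))\<^sup>2"
    unfolding power2_norm_eq_inner by (simp add: inner_simps inner_commute algebra_simps)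
  then have "L / 2 * ((norm (x' - x))\<^sup>2 - 2 * ((x - x') \<bullet> (y - x')))
      = L / 2 * ((norm (y - x))\<^sup>2 - (norm (y - x'))\<^sup>2)"
    by simp
  ultimately show ?thesis
    by (simp add: gap_def inner_simps algebra_simps)
qed

section \<open>The solution set\<close>

text \<open>At a limit \<open>l\<close> of solutions take an exact proximal gradient step to \<open>q\<close>. The step bound against
  solutions close to \<open>l\<close> shows that \<open>q\<close> is optimal and equal to \<open>l\<close>.\<close>

lemma solutions_closed: "closed (solutions F)"
  unfolding closed_sequential_limits
proof (intro allI impI, elim conjE)
  fix p :: "nat \<Rightarrow> real^'d" and l
  assume p: "\<forall>n. p n \<in> solutions F" and lim: "p \<longlonglongrightarrow> l"
  obtain q where "is_prox (1 / L) r (l - (1 / L) *\<^sub>R grad l) q"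
    using prox_exists by blast
  then have q: "inexact_step 0 l q" by (rule inexact_step_prox) simp
  have "gap q \<le> L / 2 * (norm (p n - l))\<^sup>2 - L / 2 * (norm (p n - q))\<^sup>2" for n
    using step_bound[OF q, of "p n"] p by (auto simp: solutions_iff)
  moreover have "(\<lambda>n. L / 2 * (norm (p n - l))\<^sup>2 - L / 2 * (norm (p n - q))\<^sup>2)
      \<longlonglongrightarrow> L / 2 * (norm (l - l))\<^sup>2 - L / 2 * (norm (l - q))\<^sup>2"
    by (intro tendsto_intros lim)
  ultimately have "gap q \<le> - (L / 2 * (norm (l - q))\<^sup>2)"
    using LIMSEQ_le_const by fastforce
  moreover have qd: "q \<in> dom" "0 \<le> gap q"
    using inexact_step_dom[OF q] gap_nonneg by auto
  moreover have "0 \<le> L / 2 * (norm (l - q))\<^sup>2" using L_pos by simp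
  ultimately have "gap q = 0" "L / 2 * (norm (l - q))\<^sup>2 = 0" by linarith+
  then have "gap q = 0" "l = q" using L_pos by auto
  with qd show "l \<in> solutions F" by (simp add: solutions_iff)
qed

lemma solutions_convex: "convex (solutions F)"
proof (rule convexI)
  fix x y :: "real^'d" and u v :: real
  assume xy: "x \<in> solutions F" "y \<in> solutions F" and uv: "0 \<le> u" "0 \<le> v" "u + v = 1"
  have u: "u = 1 - v" using uv(3) by simp
  have "u *\<^sub>R x + v *\<^sub>R y = x + v *\<^sub>R (y - x)"
    unfolding u by (simp add: algebra_simps)
  moreover have "x + v *\<^sub>R (y - x) \<in> dom" "gap (x + v *\<^sub>R (y - x)) \<le> 0"
    using rv_convex(1)[of x y v] gap_convex[of x y v] xy uv by (auto simp: solutions_iff)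
  ultimately show "u *\<^sub>R x + v *\<^sub>R y \<in> solutions F"
    using gap_nonneg by (auto simp: solutions_iff intro: antisym)
qed

lemma P_solution: "P x \<in> solutions F"
  unfolding P_def proj_sol_def
  by (rule closest_point_in_set[OF solutions_closed solution_exists])

lemma P_dom: "P x \<in> dom" and gap_P: "gap (P x) = 0"
  using P_solution by (auto simp: solutions_iff)

lemma P_obtuse: "p \<in> solutions F \<Longrightarrow> (x - P x) \<bullet> (p - P x) \<le> 0"
  unfolding P_def proj_sol_def
  by (rule closest_point_dot[OF solutions_convex solutions_closed])

text \<open>Optimality of \<open>p\<close> along the segment to \<open>q\<close> and convexity of \<open>r\<close> show that the tangent of \<open>f\<close> at \<open>p\<close>
  touches \<open>f\<close> at \<open>q\<close> as well. As it lies below \<open>f\<close>, both have the same gradient at \<open>q\<close>.\<close>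

lemma gradient_constant_on_solutions:
  assumes p: "p \<in> solutions F" and q: "q \<in> solutions F"
  shows "grad p = grad q"
proof -
  have d: "p \<in> dom" "q \<in> dom" and e: "f p + rv p = f q + rv q"
    using p q by (auto simp: solutions_iff gap_def)
  have "f q - f p - grad p \<bullet> (q - p) \<le> t * (L / 2 * (norm (q - p))\<^sup>2)"
    if t: "0 < t" "t < 1" for t
  proof -
    let ?z = "p + t *\<^sub>R (q - p)"
    have z: "?z \<in> dom" "rv ?z \<le> (1 - t) * rv p + t * rv q"
      using rv_convex[OF d] t by auto
    then have "f p + rv p \<le> f ?z + rv ?z"
      using gap_nonneg[OF z(1)] p by (simp add: gap_def solutions_iff)
    moreover have "f ?z \<le> f p + t * (grad p \<bullet> (q - p)) + L / 2 * (t\<^sup>2 * (norm (q - p))\<^sup>2)"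
      using smooth_below_quadratic[OF gradient lipschitz, of ?z p] by (simp add: power_mult_distrib)
    moreover have "t * f p + t * rv p = t * f q + t * rv q"
      using e by (simp flip: distrib_left)
    moreover have "t * (f q - f p - grad p \<bullet> (q - p)) = t * f q - t * f p - t * (grad p \<bullet> (q - p))"
      by (simp only: right_diff_distrib)
    moreover have "L / 2 * (t\<^sup>2 * (norm (q - p))\<^sup>2) = t * (t * (L / 2 * (norm (q - p))\<^sup>2))"
      by (simp add: power2_eq_square)
    moreover have "rv ?z \<le> rv p - t * rv p + t * rv q"
      using z(2) by (simp only: left_diff_distrib mult_1)
    ultimately have "t * (f q - f p - grad p \<bullet> (q - p)) \<le> t * (t * (L / 2 * (norm (q - p))\<^sup>2))"
      by linarith
    with t show ?thesis by simp
  qed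
  then have "f q - f p - grad p \<bullet> (q - p) \<le> 0"
    by (rule nonpos_if_le_small_multiples)
  then have upper: "f q \<le> f p + grad p \<bullet> (q - p)" by simp
  \<comment> \<open>If the gradients differed, a gradient step from \<open>q\<close> for the difference of \<open>f\<close> and the tangent
    would lead below the tangent.\<close>
  define w where "w = grad q - grad p"
  let ?y = "q - (1 / L) *\<^sub>R w"
  have "f ?y \<le> f q - (1 / L) * (grad q \<bullet> w) + (1 / (2 * L)) * (norm w)\<^sup>2"
    using smooth_below_quadratic[OF gradient lipschitz, of ?y q] L_pos
    by (simp add: power_divide power2_eq_square)
  moreover have "f p + grad p \<bullet> (?y - p) \<le> f ?y"
    by (rule convex_above_tangent[OF f_convex gradient])
  moreover have "grad p \<bullet> (?y - p) = grad p \<bullet> (q - p) - (1 / L) * (grad p \<bullet> w)"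
    by (simp add: inner_diff_right)
  moreover have "(1 / L) * (grad q \<bullet> w) - (1 / L) * (grad p \<bullet> w) = (1 / L) * (norm w)\<^sup>2"
    by (simp add: w_def power2_norm_eq_inner inner_diff_left diff_divide_distrib)
  ultimately have "(1 / L) * (norm w)\<^sup>2 \<le> (1 / (2 * L)) * (norm w)\<^sup>2"
    using upper by linarith
  then have "(norm w)\<^sup>2 \<le> 0" using L_pos by (simp add: field_simps)
  then show ?thesis by (simp add: w_def)
qed

section \<open>Progress of a single step\<close>

abbreviation D :: "real^'d \<Rightarrow> real" where
  "D x \<equiv> norm (x - P x)"

text \<open>The term \<open>\<eta> u\<close> for a displacement \<open>u\<close> is absorbed by \<open>- L u\<^sup>2 / 2\<close> up to \<open>\<eta>\<^sup>2 / (2 L)\<close>.\<close>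

lemma step_towards_solution:
  assumes step: "inexact_step \<eta> x x'" and x: "x \<in> dom" and t: "0 \<le> t" "t \<le> 1"
  shows "gap x' \<le> (1 - t) * gap x + L / 2 * t\<^sup>2 * (D x)\<^sup>2 + \<eta>\<^sup>2 / (2 * L)"
proof -
  let ?y = "x + t *\<^sub>R (P x - x)"
  have y: "?y \<in> dom" "gap ?y \<le> (1 - t) * gap x"
    using rv_convex(1)[OF x P_dom t] gap_convex[OF x P_dom t] by (simp_all add: gap_P)
  have "gap x' \<le> gap ?y + L / 2 * (norm (?y - x))\<^sup>2 - L / 2 * (norm (?y - x'))\<^sup>2 + \<eta> * norm (x' - ?y)"
    by (rule step_bound[OF step y(1)])
  moreover have "(norm (?y - x))\<^sup>2 = t\<^sup>2 * (D x)\<^sup>2"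
    by (simp add: power_mult_distrib norm_minus_commute)
  then have "L / 2 * (norm (?y - x))\<^sup>2 = L / 2 * t\<^sup>2 * (D x)\<^sup>2" by simp
  moreover have "\<eta> * u - L / 2 * u\<^sup>2 \<le> \<eta>\<^sup>2 / (2 * L)" for u
  proof -
    have "0 \<le> (\<eta> - L * u)\<^sup>2" by simp
    then show ?thesis using L_pos by (simp add: field_simps power2_eq_square)
  qed
  from this[of "norm (x' - ?y)"]
  have "\<eta> * norm (x' - ?y) - L / 2 * (norm (?y - x'))\<^sup>2 \<le> \<eta>\<^sup>2 / (2 * L)"
    by (simp only: norm_minus_commute)
  ultimately show ?thesis using y(2) by linarith
qed

text \<open>The subgradient inequality for \<open>r\<close> at \<open>x'\<close> and the quadratic upper bound of \<open>f\<close> at \<open>P x'\<close> bound the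
  gap by scalar products with \<open>w = x' - P x'\<close>. A movement parallel to the solution set, however long,
  does not matter: \<open>grad (P x')\<close> equals \<open>grad (P x)\<close>, which is close to \<open>grad x\<close>, and the angle
  between \<open>w\<close> and \<open>P x - P x'\<close> is never acute.\<close>

lemma step_gap_le_distances:
  assumes "inexact_step \<eta> x x'"
  shows "gap x' \<le> (2 * L * D x + \<eta>) * D x'"
proof -
  obtain g where g: "norm (grad x - g) \<le> \<eta>"
    and sub: "L *\<^sub>R (x - x') - g \<in> subdifferential r x'"
    using assms(1) by (auto simp: inexact_step_def norm_minus_commute)
  define w where "w = x' - P x'"
  have "rv x' + (L *\<^sub>R (x - x') - g) \<bullet> (P x' - x') \<le> rv (P x')"
    by (rule subgradient(2)[OF sub P_dom])
  then have "rv x' \<le> rv (P x') + (L *\<^sub>R (x - x') - g) \<bullet> w"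
    by (simp add: w_def inner_diff_right)
  then have 1: "rv x' \<le> rv (P x') + L * ((x - x') \<bullet> w) - g \<bullet> w"
    by (simp add: inner_diff_left algebra_simps)
  have "f x' \<le> f (P x') + grad (P x') \<bullet> w + L / 2 * (norm w)\<^sup>2"
    unfolding w_def by (rule smooth_below_quadratic[OF gradient lipschitz])
  moreover have "grad (P x') = grad (P x)"
    by (rule gradient_constant_on_solutions[OF P_solution P_solution])
  ultimately have 2: "f x' \<le> f (P x') + grad (P x) \<bullet> w + L / 2 * (norm w)\<^sup>2" by simp
  have "norm (grad (P x) - grad x) \<le> L * D x"
    using lipschitz[of "P x" x] by (simp add: norm_minus_commute)
  from inner_le_norm_bound[OF this, of w]
  have 3: "grad (P x) \<bullet> w - grad x \<bullet> w \<le> L * D x * norm w" by (simp add: inner_diff_left)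
  have 4: "grad x \<bullet> w - g \<bullet> w \<le> \<eta> * norm w"
    using inner_le_norm_bound[OF g, of w] by (simp add: inner_diff_left)
  have "(x - x') \<bullet> w = (x - P x) \<bullet> w + w \<bullet> (P x - P x') - (norm w)\<^sup>2"
    unfolding power2_norm_eq_inner by (simp add: w_def inner_simps inner_commute)
  moreover have "w \<bullet> (P x - P x') \<le> 0" unfolding w_def by (rule P_obtuse[OF P_solution])
  moreover have "(x - P x) \<bullet> w \<le> D x * norm w" by (rule norm_cauchy_schwarz)
  ultimately have "(x - x') \<bullet> w \<le> D x * norm w - (norm w)\<^sup>2" by linarith
  then have "L * ((x - x') \<bullet> w) \<le> L * (D x * norm w - (norm w)\<^sup>2)"
    using L_pos by simp
  then have 5: "L * ((x - x') \<bullet> w) \<le> L * D x * norm w - L * (norm w)\<^sup>2"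
    by (simp add: right_diff_distrib)
  have 6: "0 \<le> L * (norm w)\<^sup>2" using L_pos by simp
  have "gap x' = (f x' + rv x') - (f (P x') + rv (P x'))"
    using gap_P[of x'] by (simp add: gap_def)
  also have "\<dots> \<le> 2 * (L * D x * norm w) + \<eta> * norm w"
    using 1 2 3 4 5 6 by linarith
  also have "\<dots> = (2 * L * D x + \<eta>) * D x'" by (simp add: w_def algebra_simps)
  finally show ?thesis .
qed

section \<open>Convergence rates\<close>

text \<open>If the gaps \<open>e\<^sub>k\<close> exceeded \<open>\<epsilon>\<close> up to \<open>K\<close>, the invariant \<open>k e\<^sub>k \<le> 5 L R\<^sup>2\<close> for \<open>k \<ge> 1\<close> would contradict
  \<open>18 L R\<^sup>2 \<le> K \<epsilon>\<close>. The case \<open>k = 1\<close> needs the bound on the distance of the new iterate too, through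
  \<open>step_gap_le_distances\<close>.\<close>

lemma sublinear_rate:
  fixes x :: "nat \<Rightarrow> real^'d"
  assumes step: "\<And>k. inexact_step \<eta> (x k) (x (Suc k))" and "x 0 \<in> dom" and "0 \<le> \<eta>"
    and R: "\<And>k. D (x k) \<le> R"
    and "0 < \<epsilon>" and \<epsilon>: "10 * \<eta> * R \<le> \<epsilon>"
    and K: "18 * L * R\<^sup>2 / \<epsilon> \<le> real K"
  shows "\<exists>k\<le>K. gap (x k) \<le> \<epsilon>"
proof (rule ccontr)
  assume "\<not> ?thesis"
  then have large: "\<epsilon> < gap (x k)" if "k \<le> K" for k
    using that by (meson not_le)
  have dom: "x k \<in> dom" for k
    using \<open>x 0 \<in> dom\<close> inexact_step_dom[OF step] by (cases k) auto
  have "R \<noteq> 0"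
  proof
    assume "R = 0"
    then have "x 0 = P (x 0)" using R[of 0] by simp
    then have "gap (x 0) = 0" using gap_P[of "x 0"] by simp
    then show False using large[of 0] \<open>0 < \<epsilon>\<close> by simp
  qed
  moreover have "0 \<le> R" using R[of 0] norm_ge_zero order.trans by blast
  ultimately have "0 < R" by simp
  define A where "A = L * R\<^sup>2"
  have "0 < A" using \<open>0 < R\<close> L_pos by (simp add: A_def)
  have KA: "18 * A \<le> real K * \<epsilon>" using K \<open>0 < \<epsilon>\<close> by (simp add: A_def field_simps)
  have "1 \<le> K" using KA \<open>0 < A\<close> by (cases K) auto
  \<comment> \<open>A single step forgets the initial gap.\<close>
  have upper: "gap (x (Suc k)) \<le> 4 * A" if "Suc k \<le> K" for k
  proof -
    have "gap (x (Suc k)) \<le> (2 * L * D (x k) + \<eta>) * D (x (Suc k))"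
      by (rule step_gap_le_distances[OF step])
    also have "\<dots> \<le> (2 * L * R + \<eta>) * R"
      using R L_pos \<open>0 \<le> \<eta>\<close> \<open>0 < R\<close> by (intro mult_mono add_mono) auto
    also have "\<dots> \<le> 2 * A + \<epsilon> / 10" using \<epsilon> by (simp add: A_def power2_eq_square algebra_simps)
    finally show ?thesis using large[OF that] \<open>0 < A\<close> by linarith
  qed
  have noise: "\<eta>\<^sup>2 / (2 * L) \<le> \<epsilon>\<^sup>2 / (200 * A)"
  proof -
    have "(10 * \<eta> * R)\<^sup>2 \<le> \<epsilon>\<^sup>2" using \<epsilon> \<open>0 \<le> \<eta>\<close> \<open>0 < R\<close> by (intro power_mono) auto
    then show ?thesis using L_pos \<open>0 < R\<close> by (simp add: A_def field_simps power2_eq_square)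
  qed
  have "real (Suc k) * gap (x (Suc k)) \<le> 5 * A" if "Suc k \<le> K" for k
    using that
  proof (induction k)
    case 0
    then show ?case using upper[of 0] \<open>0 < A\<close> by simp
  next
    case (Suc k)
    define e where "e = gap (x (Suc k))"
    define b where "b = e / (5 * A)"
    have e: "\<epsilon> < e" "e \<le> 4 * A" "real (Suc k) * e \<le> 5 * A"
      using large[of "Suc k"] upper[of k] Suc by (auto simp: e_def)
    \<comment> \<open>The step fraction \<open>t = e / (4 A)\<close> is admissible by \<open>upper\<close>; it is of the order of the minimizer
      \<open>e / A\<close> of the bound.\<close>
    have "gap (x (Suc (Suc k))) \<le> (1 - e / (4 * A)) * e
        + L / 2 * (e / (4 * A))\<^sup>2 * (D (x (Suc k)))\<^sup>2 + \<eta>\<^sup>2 / (2 * L)"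
      unfolding e_def
      using e \<open>0 < \<epsilon>\<close> \<open>0 < A\<close> by (intro step_towards_solution[OF step dom]) (auto simp: e_def)
    also have "\<dots> \<le> (1 - e / (4 * A)) * e + L / 2 * (e / (4 * A))\<^sup>2 * R\<^sup>2 + e\<^sup>2 / (200 * A)"
    proof (intro add_mono order_refl mult_left_mono)
      show "(D (x (Suc k)))\<^sup>2 \<le> R\<^sup>2" using R by (intro power_mono) auto
      have "\<epsilon>\<^sup>2 / (200 * A) \<le> e\<^sup>2 / (200 * A)"
        using e \<open>0 < \<epsilon>\<close> \<open>0 < A\<close> by (intro divide_right_mono power_mono) auto
      with noise show "\<eta>\<^sup>2 / (2 * L) \<le> e\<^sup>2 / (200 * A)" by linarith
    qed (use L_pos in auto)
    also have "\<dots> = e - (1 / 4 - 1 / 32 - 1 / 200) * (e\<^sup>2 / A)"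
    proof -
      have "L / 2 * (e / (4 * A))\<^sup>2 * R\<^sup>2 = A * (e / (4 * A))\<^sup>2 / 2" by (simp add: A_def)
      also have "\<dots> = (e\<^sup>2 / A) / 32" using \<open>0 < A\<close> by (simp add: field_simps power2_eq_square)
      finally have "L / 2 * (e / (4 * A))\<^sup>2 * R\<^sup>2 = (e\<^sup>2 / A) / 32" .
      moreover have "(1 - e / (4 * A)) * e = e - (e\<^sup>2 / A) / 4"
        by (simp add: power2_eq_square algebra_simps)
      ultimately show ?thesis by simp
    qed
    also have "\<dots> \<le> e - 1 / 5 * (e\<^sup>2 / A)"
      using \<open>0 < A\<close> by (intro diff_left_mono mult_right_mono) auto
    also have "\<dots> = 5 * A * (b - b\<^sup>2)"
      using \<open>0 < A\<close> by (simp add: b_def field_simps power2_eq_square)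
    finally have le: "gap (x (Suc (Suc k))) \<le> 5 * A * (b - b\<^sup>2)" .
    define j where "j = real (Suc k)"
    have j: "1 \<le> j" "real (Suc (Suc k)) = j + 1" by (simp_all add: j_def)
    have b: "0 \<le> b" "j * b \<le> 1"
      using e \<open>0 < \<epsilon>\<close> \<open>0 < A\<close> by (simp_all add: b_def j_def)
    have "b \<le> 1" using mult_right_mono[OF j(1) b(1)] b(2) by linarith
    then have le_one: "b * (1 - j * b) \<le> 1 * (1 - j * b)"
      using b(2) by (intro mult_right_mono) auto
    have "(j + 1) * (b - b\<^sup>2) = j * b + b * (1 - j * b) - b\<^sup>2"
      by (simp add: algebra_simps power2_eq_square)
    also have "\<dots> \<le> j * b + 1 * (1 - j * b) - 0"
      using le_one by (intro diff_mono add_left_mono) auto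
    finally have 1: "(j + 1) * (b - b\<^sup>2) \<le> 1" by simp
    have "real (Suc (Suc k)) * gap (x (Suc (Suc k))) \<le> real (Suc (Suc k)) * (5 * A * (b - b\<^sup>2))"
      using le by (intro mult_left_mono) auto
    also have "\<dots> = 5 * A * ((j + 1) * (b - b\<^sup>2))" unfolding j(2) by simp
    also have "\<dots> \<le> 5 * A * 1" using 1 \<open>0 < A\<close> by (intro mult_left_mono) auto
    finally show ?case by simp
  qed
  from this[of "K - 1"] have "real K * gap (x K) \<le> 5 * A" using \<open>1 \<le> K\<close> by simp
  moreover have "real K * \<epsilon> \<le> real K * gap (x K)" using large[of K] by (intro mult_left_mono) auto
  ultimately show False using KA \<open>0 < A\<close> by linarith
qed

text \<open>With \<open>c = \<nu> / L\<close> there are three regimes. For \<open>c \<le> 2\<close> the optimal \<open>t = c / 2\<close> in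
  \<open>step_towards_solution\<close> gives the factor \<open>1 - c / 4\<close>; for \<open>2 \<le> c \<le> 8\<close> the choice \<open>t = 1\<close> gives \<open>1 / c\<close>.
  Beyond that, \<open>q\<close> decays like \<open>1 / c\<^sup>2\<close>, which only \<open>step_gap_le_distances\<close> can match: both of its
  factors are controlled by quadratic growth, and the result is \<open>32 / c\<^sup>2\<close>.\<close>

lemma strongly_convex_step:
  assumes step: "inexact_step \<eta> x x'" and x: "x \<in> dom" and "0 < \<nu>"
    and growth: "\<And>y. y \<in> dom \<Longrightarrow> \<nu> / 2 * (D y)\<^sup>2 \<le> gap y"
  defines "q \<equiv> (24 * L / (\<nu> + 24 * L))\<^sup>2"
  shows "gap x' \<le> q * gap x + (1 - q) * (100 * (\<eta>\<^sup>2 / \<nu>))"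
proof -
  define c where "c = \<nu> / L"
  have "0 < c" using \<open>0 < \<nu>\<close> L_pos by (simp add: c_def)
  have \<nu>: "\<nu> = c * L" using L_pos by (simp add: c_def)
  have q: "q = 576 / (c + 24)\<^sup>2"
  proof -
    have "\<nu> + 24 * L = (c + 24) * L" by (simp add: \<nu> distrib_right)
    then have "24 * L / (\<nu> + 24 * L) = 24 / (c + 24)" using L_pos by simp
    then show ?thesis by (simp add: q_def power_divide)
  qed
  have q_ge: "a \<le> q" if "a * (c + 24)\<^sup>2 \<le> 576" for a
    using that \<open>0 < c\<close> unfolding q by (simp add: pos_le_divide_eq)
  have q_le: "q \<le> a" if "576 \<le> a * (c + 24)\<^sup>2" for a
    using that \<open>0 < c\<close> unfolding q by (simp add: pos_divide_le_eq)
  define N where "N = \<eta>\<^sup>2 / \<nu>"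
  have "0 \<le> N" using \<open>0 < \<nu>\<close> by (simp add: N_def)
  have noise: "\<eta>\<^sup>2 / (2 * L) = c / 2 * N"
    using L_pos \<open>0 < c\<close> unfolding N_def \<nu> by (simp add: field_simps)
  have gap: "0 \<le> gap x" "0 \<le> gap x'"
    using gap_nonneg x inexact_step_dom[OF step] by auto
  have dist: "L * (D x)\<^sup>2 \<le> 2 * gap x / c"
    using growth[OF x] \<open>0 < c\<close> unfolding \<nu> by (simp add: field_simps)
  have conclude: "gap x' \<le> q * gap x + (1 - q) * (100 * N)"
    if "gap x' \<le> a * gap x + b * N" "a \<le> q" "b \<le> (1 - q) * 100" for a b
  proof -
    have "a * gap x \<le> q * gap x" using that(2) gap(1) by (rule mult_right_mono)
    moreover have "b * N \<le> (1 - q) * (100 * N)"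
      using mult_right_mono[OF that(3) \<open>0 \<le> N\<close>] by (simp only: mult.assoc)
    ultimately show ?thesis using that(1) by linarith
  qed
  have towards: "gap x' \<le> (1 - t + t\<^sup>2 / c) * gap x + c / 2 * N" if t: "0 \<le> t" "t \<le> 1" for t
  proof -
    have "L / 2 * t\<^sup>2 * (D x)\<^sup>2 = t\<^sup>2 / 2 * (L * (D x)\<^sup>2)" by simp
    also have "\<dots> \<le> t\<^sup>2 / 2 * (2 * gap x / c)" using dist by (rule mult_left_mono) simp
    finally have "L / 2 * t\<^sup>2 * (D x)\<^sup>2 \<le> t\<^sup>2 / c * gap x" by simp
    with step_towards_solution[OF step x t] show ?thesis
      unfolding noise by (simp add: algebra_simps)
  qed
  have "gap x' \<le> q * gap x + (1 - q) * (100 * N)"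
  proof (cases "c \<le> 8")
    case True
    have "c * c \<le> 8 * c" using True \<open>0 < c\<close> by (intro mult_right_mono) auto
    then have "c * (c * c) \<le> c * (8 * c)" using \<open>0 < c\<close> by (intro mult_left_mono) auto
    then have ccc: "c * (c * c) \<le> 8 * (c * c)" by (simp only: mult.left_commute)
    have "576 \<le> 576 + 48 * c + u - (v + 48 * u + 576 * c) / 200"
      if "v \<le> 8 * u" "0 \<le> u" for u v :: real
      using that \<open>0 < c\<close> by (simp add: field_simps)
    from this[OF ccc]
    have "576 \<le> 576 + 48 * c + c * c - (c * (c * c) + 48 * (c * c) + 576 * c) / 200"
      by simp
    also have "\<dots> = (1 - c / 200) * (c + 24)\<^sup>2"
      by (simp add: power2_eq_square field_simps)
    finally have "q \<le> 1 - c / 200" by (rule q_le)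
    then have b: "c / 2 \<le> (1 - q) * 100" by simp
    show ?thesis
    proof (cases "c \<le> 2")
      case True
      have "1 - c / 4 \<le> q"
        using \<open>0 < c\<close> by (intro q_ge) (simp add: power2_eq_square algebra_simps)
      moreover have "1 - c / 2 + (c / 2)\<^sup>2 / c = 1 - c / 4"
        using \<open>0 < c\<close> by (simp add: field_simps power2_eq_square)
      ultimately show ?thesis
        using conclude[OF towards[of "c / 2"] _ b] \<open>0 < c\<close> True by simp
    next
      case False
      have "1 / c \<le> q"
      proof (rule q_ge)
        have "c * c + 576 \<le> 528 * c" using \<open>c * c \<le> 8 * c\<close> False by linarith
        then have "(c + 24)\<^sup>2 \<le> 576 * c" by (simp add: power2_eq_square algebra_simps)
        then show "1 / c * (c + 24)\<^sup>2 \<le> 576" using \<open>0 < c\<close> by (simp add: field_simps)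
      qed
      then show ?thesis using conclude[OF towards[of 1] _ b] by simp
    qed
  next
    case False
    have a: "32 / c\<^sup>2 \<le> q"
    proof (rule q_ge)
      have "(c + 24)\<^sup>2 \<le> (4 * c)\<^sup>2" using False by (intro power_mono) auto
      also have "\<dots> \<le> 18 * c\<^sup>2" by (simp add: power_mult_distrib)
      finally have "32 * (c + 24)\<^sup>2 \<le> 576 * c\<^sup>2" by simp
      then show "32 / c\<^sup>2 * (c + 24)\<^sup>2 \<le> 576" using \<open>0 < c\<close> by (simp add: field_simps)
    qed
    have "(32::real)\<^sup>2 \<le> (c + 24)\<^sup>2" using False by (intro power_mono) auto
    then have "q \<le> 24 / 25" by (intro q_le) simp
    then have b: "4 \<le> (1 - q) * 100" by simp
    let ?B = "2 * L * D x + \<eta>"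
    have "gap x' \<le> 2 / \<nu> * ?B\<^sup>2"
    proof (cases "gap x' = 0")
      case True
      then show ?thesis using \<open>0 < \<nu>\<close> by simp
    next
      case False
      have "gap x' * gap x' \<le> (?B * D x') * (?B * D x')"
        using step_gap_le_distances[OF step] gap(2) by (intro mult_mono) auto
      also have "\<dots> = ?B\<^sup>2 * (D x')\<^sup>2" by (simp add: power2_eq_square)
      also have "\<dots> \<le> ?B\<^sup>2 * (2 * gap x' / \<nu>)"
        using growth[OF inexact_step_dom[OF step]] \<open>0 < \<nu>\<close>
        by (intro mult_left_mono) (simp_all add: field_simps)
      finally have "gap x' * gap x' \<le> (2 / \<nu> * ?B\<^sup>2) * gap x'" by (simp add: mult_ac)
      moreover have "0 < gap x'" using False gap(2) by simp
      ultimately show ?thesis by (rule mult_right_le_imp_le)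
    qed
    also have "\<dots> \<le> 2 / \<nu> * (8 * L * (L * (D x)\<^sup>2) + 2 * \<eta>\<^sup>2)"
    proof -
      have "?B\<^sup>2 \<le> 2 * (2 * L * D x)\<^sup>2 + 2 * \<eta>\<^sup>2"
        using zero_le_power2[of "2 * L * D x - \<eta>"] by (simp add: power2_eq_square algebra_simps)
      also have "\<dots> = 8 * L * (L * (D x)\<^sup>2) + 2 * \<eta>\<^sup>2" by (simp add: power2_eq_square)
      finally show ?thesis using \<open>0 < \<nu>\<close> by (intro mult_left_mono) auto
    qed
    also have "\<dots> \<le> 2 / \<nu> * (8 * L * (2 * gap x / c) + 2 * \<eta>\<^sup>2)"
      using dist \<open>0 < \<nu>\<close> L_pos by (intro mult_left_mono add_right_mono) auto
    also have "\<dots> = 32 / c\<^sup>2 * gap x + 4 * N"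
      using L_pos \<open>0 < c\<close> unfolding N_def \<nu> by (simp add: field_simps power2_eq_square)
    finally show ?thesis using a b by (rule conclude)
  qed
  then show ?thesis by (simp add: N_def)
qed

text \<open>The factor 2 before \<open>K\<close> is the square in the contraction factor.\<close>

lemma linear_rate:
  fixes x :: "nat \<Rightarrow> real^'d"
  assumes step: "\<And>k. inexact_step \<eta> (x k) (x (Suc k))" and x0: "x 0 \<in> dom" and "0 < \<nu>"
    and growth: "\<And>y. y \<in> dom \<Longrightarrow> \<nu> / 2 * (D y)\<^sup>2 \<le> gap y"
    and \<epsilon>: "100 * (\<eta>\<^sup>2 / \<nu>) < \<epsilon>"
    and K: "ln ((\<epsilon> - 100 * (\<eta>\<^sup>2 / \<nu>)) / gap (x 0)) / (ln (24 * L) - ln (\<nu> + 24 * L)) \<le> 2 * real K"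
  shows "\<exists>k\<le>K. gap (x k) \<le> \<epsilon>"
proof (cases "gap (x 0) \<le> \<epsilon>")
  case False
  define B where "B = 100 * (\<eta>\<^sup>2 / \<nu>)"
  have B: "0 \<le> B" "B < \<epsilon>" using \<epsilon> \<open>0 < \<nu>\<close> by (simp_all add: B_def)
  define \<Lambda> where "\<Lambda> = ln (\<nu> + 24 * L) - ln (24 * L)"
  have "0 < \<Lambda>" using L_pos \<open>0 < \<nu>\<close> by (simp add: \<Lambda>_def)
  have ratio: "24 * L / (\<nu> + 24 * L) = exp (- \<Lambda>)"
    using L_pos \<open>0 < \<nu>\<close> by (simp add: \<Lambda>_def exp_diff)
  define q where "q = (24 * L / (\<nu> + 24 * L))\<^sup>2"
  have q: "q = exp (- (2 * \<Lambda>))"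
    unfolding q_def ratio by (simp flip: exp_of_nat_mult)
  have dom: "x k \<in> dom" for k
    using x0 inexact_step_dom[OF step] by (cases k) auto
  have decay: "gap (x k) \<le> q ^ k * gap (x 0) + B" for k
  proof (induction k)
    case (Suc k)
    have "gap (x (Suc k)) \<le> q * gap (x k) + (1 - q) * B"
      unfolding q_def B_def by (rule strongly_convex_step[OF step dom \<open>0 < \<nu>\<close> growth])
    also have "\<dots> \<le> q * (q ^ k * gap (x 0) + B) + (1 - q) * B"
      using Suc q by (intro add_right_mono mult_left_mono) auto
    finally show ?case by (simp add: algebra_simps)
  qed (use B in simp)
  have e0: "0 < gap (x 0)" using False B by linarith
  define w where "w = (\<epsilon> - B) / gap (x 0)"
  have "0 < w" using B e0 by (simp add: w_def)
  have "ln w / (- \<Lambda>) \<le> 2 * real K" using K by (simp add: w_def B_def \<Lambda>_def)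
  then have "real K * (- (2 * \<Lambda>)) \<le> ln w" using \<open>0 < \<Lambda>\<close> by (simp add: field_simps)
  then have "exp (real K * (- (2 * \<Lambda>))) \<le> w" using \<open>0 < w\<close> by (simp flip: ln_ge_iff)
  then have "q ^ K \<le> w" unfolding q by (simp flip: exp_of_nat_mult)
  then have "q ^ K * gap (x 0) \<le> \<epsilon> - B" using e0 by (simp add: w_def pos_le_divide_eq)
  with decay[of K] show ?thesis by (intro exI[of _ K]) simp
qed auto

section \<open>Boundedness of the iterates\<close>

text \<open>The values of \<open>F\<close> stay below the maximum of \<open>F x0\<close> and of a bound \<open>C\<close> for the points at which \<open>F\<close>
  has a subgradient of norm at most \<open>5 \<eta>\<close>. The radius depends on \<open>\<eta>\<close> and \<open>x0\<close> only, and not on the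
  particular run.\<close>

lemma iterates_bounded:
  assumes coer: "coercive F" and sub_coer: "subdiff_coercive F (\<lambda>x. (\<lambda>u. grad x + u) ` subdifferential r x)"
    and x0: "x0 \<in> dom"
  shows "\<exists>R\<ge>0. \<forall>x. x 0 = x0 \<longrightarrow> (\<forall>k. inexact_step \<eta> (x k) (x (Suc k))) \<longrightarrow> (\<forall>k. D (x k) \<le> R)"
proof -
  \<comment> \<open>Both coercivity assumptions speak of sequences; a set without a bound supplies one.\<close>
  have F_top: "(\<lambda>n. F (X n)) \<longlonglongrightarrow> \<infinity>" if "\<And>n. X n \<in> dom" "\<And>n. real n < gap (X n)" for X
  proof -
    have "filterlim (\<lambda>n. gap (X n)) at_top sequentially"
      by (rule filterlim_at_top_mono[OF filterlim_real_sequentially]) (simp add: less_imp_le that)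
    then have "filterlim (\<lambda>n. Fopt + gap (X n)) at_top sequentially"
      by (rule filterlim_tendsto_add_at_top[OF tendsto_const])
    moreover have "F (X n) = ereal (Fopt + gap (X n))" for n
      using that by (simp add: F_on_dom gap_def)
    ultimately show ?thesis by (simp add: tendsto_PInfty_eq_at_top)
  qed
  have "\<exists>C. \<forall>y\<in>dom. (\<exists>u\<in>subdifferential r y. norm (grad y + u) \<le> 5 * \<eta>) \<longrightarrow> gap y \<le> C"
  proof (rule ccontr)
    assume "\<not> ?thesis"
    then have "\<exists>y. y \<in> dom \<and> (\<exists>u\<in>subdifferential r y. norm (grad y + u) \<le> 5 * \<eta>) \<and> real n < gap y" for n
      by (meson not_le)
    then obtain X where X: "\<And>n. X n \<in> dom" "\<And>n. real n < gap (X n)"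
      "\<And>n. \<exists>u\<in>subdifferential r (X n). norm (grad (X n) + u) \<le> 5 * \<eta>"
      by metis
    have "(\<lambda>n. INF u\<in>(\<lambda>u. grad (X n) + u) ` subdifferential r (X n). ereal (norm u)) \<longlonglongrightarrow> \<infinity>"
      using sub_coer F_top[OF X(1,2)] by (simp add: subdiff_coercive_def)
    then have "\<forall>\<^sub>F n in sequentially. ereal (5 * \<eta>)
        < (INF u\<in>(\<lambda>u. grad (X n) + u) ` subdifferential r (X n). ereal (norm u))"
      by (simp add: tendsto_PInfty)
    then obtain n where "ereal (5 * \<eta>)
        < (INF u\<in>(\<lambda>u. grad (X n) + u) ` subdifferential r (X n). ereal (norm u))"
      by (auto simp: eventually_sequentially)
    moreover obtain u where "u \<in> subdifferential r (X n)" "norm (grad (X n) + u) \<le> 5 * \<eta>"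
      using X(3) by blast
    then have "(INF u\<in>(\<lambda>u. grad (X n) + u) ` subdifferential r (X n). ereal (norm u)) \<le> ereal (5 * \<eta>)"
      by (intro INF_lower2[of "grad (X n) + u"]) auto
    ultimately show False by simp
  qed
  then obtain C where C: "\<And>y u. y \<in> dom \<Longrightarrow> u \<in> subdifferential r y \<Longrightarrow>
      norm (grad y + u) \<le> 5 * \<eta> \<Longrightarrow> gap y \<le> C"
    by blast
  define C' where "C' = max (gap x0) C"
  have "\<exists>R. \<forall>y\<in>dom. gap y \<le> C' \<longrightarrow> D y \<le> R"
  proof (rule ccontr)
    assume "\<not> ?thesis"
    then have "\<exists>y. y \<in> dom \<and> gap y \<le> C' \<and> real n < D y" for n by (meson not_le)
    then obtain X where X: "\<And>n. X n \<in> dom" "\<And>n. gap (X n) \<le> C'" "\<And>n. real n < D (X n)"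
      by metis
    have "filterlim (\<lambda>n. D (X n)) at_top sequentially"
      by (rule filterlim_at_top_mono[OF filterlim_real_sequentially]) (simp add: less_imp_le X)
    then have "(\<lambda>n. F (X n)) \<longlonglongrightarrow> \<infinity>"
      using coer by (simp add: coercive_def P_def)
    then have "\<forall>\<^sub>F n in sequentially. ereal (Fopt + C') < F (X n)"
      by (simp add: tendsto_PInfty)
    then obtain n where "ereal (Fopt + C') < F (X n)"
      by (auto simp: eventually_sequentially)
    then show False using X(1,2)[of n] by (simp add: F_on_dom gap_def)
  qed
  then obtain R where R: "\<And>y. y \<in> dom \<Longrightarrow> gap y \<le> C' \<Longrightarrow> D y \<le> R" by blast
  have "D (x k) \<le> max 0 R" if x: "x 0 = x0" "\<And>k. inexact_step \<eta> (x k) (x (Suc k))" for x k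
  proof -
    have dom: "x k \<in> dom" for k
      using x0 inexact_step_dom[OF x(2)] x(1) by (cases k) auto
    have "gap (x k) \<le> C'" for k
    proof (induction k)
      case 0
      then show ?case by (simp add: x C'_def)
    next
      case (Suc k)
      let ?M = "norm (x k - x (Suc k))"
      show ?case
      proof (cases "L * ?M \<le> 2 * \<eta>")
        \<comment> \<open>A short step: the new point has a small subgradient.\<close>
        case True
        obtain g where g: "norm (grad (x k) - g) \<le> \<eta>"
          and sub: "L *\<^sub>R (x k - x (Suc k)) - g \<in> subdifferential r (x (Suc k))"
          using x(2)[of k] by (auto simp: inexact_step_def norm_minus_commute)
        let ?v = "L *\<^sub>R (x k - x (Suc k)) - g"
        have "grad (x (Suc k)) + ?v = (grad (x (Suc k)) - grad (x k)) + (grad (x k) - g) + L *\<^sub>R (x k - x (Suc k))"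
          by simp
        then have "norm (grad (x (Suc k)) + ?v) \<le> norm (grad (x (Suc k)) - grad (x k))
            + norm (grad (x k) - g) + norm (L *\<^sub>R (x k - x (Suc k)))"
          by (metis norm_triangle_mono order_refl)
        also have "\<dots> \<le> L * ?M + \<eta> + L * ?M"
          using lipschitz[of "x (Suc k)" "x k"] g L_pos
          by (intro add_mono) (auto simp: norm_minus_commute)
        also have "\<dots> \<le> 5 * \<eta>" using True by simp
        finally have "gap (x (Suc k)) \<le> C" by (rule C[OF dom sub])
        then show ?thesis by (simp add: C'_def)
      next
        \<comment> \<open>A long step: comparison with \<open>x k\<close> itself shows descent.\<close>
        case False
        have "gap (x (Suc k)) \<le> gap (x k) - L / 2 * ?M\<^sup>2 + \<eta> * ?M"
          using step_bound[OF x(2) dom, of k k] by (simp add: norm_minus_commute)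
        also have "\<dots> = gap (x k) - ?M / 2 * (L * ?M - 2 * \<eta>)"
          by (simp add: power2_eq_square algebra_simps)
        also have "\<dots> \<le> gap (x k)" using False by simp
        finally show ?thesis using Suc by simp
      qed
    qed
    then show ?thesis using R[OF dom] by (simp add: max.coboundedI2)
  qed
  then show ?thesis by (intro exI[of _ "max 0 R"]) auto
qed

end

section \<open>Counting queries\<close>

text \<open>The loss of a factor 2 comes from the \<open>m + 1\<close> queries of an iteration, as \<open>m / (m + 1)\<close> may be as
  small as \<open>1 / 2\<close>.\<close>

lemma iterations_within_query_bound:
  fixes b :: real
  assumes "0 < m" and m: "m = nat \<lfloor>b * ln (real d / s)\<rfloor>" and s: "1 \<le> s" "0 < d" and b: "0 < b"
    and "0 \<le> X"
  shows "X \<le> 2 * real (nat \<lceil>b * ln (real d) * X / real (m + 1)\<rceil>)"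
proof -
  have "real m \<le> b * ln (real d / s)"
    using \<open>0 < m\<close> unfolding m by linarith
  also have "\<dots> \<le> b * ln (real d)"
    using s b by (intro mult_left_mono) (simp_all add: ln_div)
  finally have "real m * X \<le> b * ln (real d) * X" using \<open>0 \<le> X\<close> by (intro mult_right_mono)
  moreover have "real (m + 1) * X \<le> 2 * real m * X"
    using \<open>0 < m\<close> \<open>0 \<le> X\<close> by (intro mult_right_mono) auto
  ultimately have "X / 2 \<le> b * ln (real d) * X / real (m + 1)"
    by (simp add: field_simps)
  then show ?thesis by linarith
qed

text \<open>The condition on \<open>b\<close> keeps \<open>\<epsilon> - b\<close> between \<open>(1 - \<theta>) \<epsilon>\<close> and \<open>\<epsilon>\<close>, and \<open>\<bar>ln (1 / \<epsilon>)\<bar> \<ge> 1\<close> absorbs the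
  constants once \<open>\<epsilon> \<le> exp (- 1)\<close>. For \<open>e0 = 0\<close> the left-hand side is zero, as \<open>x / 0 = 0\<close> and
  \<open>ln 0 = 0\<close>.\<close>

lemma log_ratio_bigo:
  fixes e0 \<theta> :: real
  assumes "0 \<le> e0" and \<theta>: "\<theta> < 1"
  shows "\<exists>C. \<forall>\<^sub>F \<epsilon> in at_right 0. \<forall>b. 0 \<le> b \<longrightarrow> b \<le> \<theta> * \<epsilon> \<longrightarrow> \<bar>ln ((\<epsilon> - b) / e0)\<bar> \<le> C * \<bar>ln (1 / \<epsilon>)\<bar>"
proof (cases "e0 = 0")
  case True
  then show ?thesis by (intro exI[of _ 0]) simp
next
  case False
  define C where "C = \<bar>ln (1 - \<theta>)\<bar> + \<bar>ln e0\<bar>"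
  have "\<forall>\<^sub>F \<epsilon> in at_right 0. 0 < \<epsilon> \<and> \<epsilon> < exp (- 1 :: real)"
    using eventually_at_right_real[of 0 "exp (- 1)"] by simp
  then have "\<forall>\<^sub>F \<epsilon> in at_right 0. \<forall>b. 0 \<le> b \<longrightarrow> b \<le> \<theta> * \<epsilon> \<longrightarrow>
      \<bar>ln ((\<epsilon> - b) / e0)\<bar> \<le> (1 + C) * \<bar>ln (1 / \<epsilon>)\<bar>"
  proof (rule eventually_mono, intro allI impI, elim conjE)
    fix \<epsilon> b :: real
    assume \<epsilon>: "0 < \<epsilon>" "\<epsilon> < exp (- 1)" and b: "0 \<le> b" "b \<le> \<theta> * \<epsilon>"
    have "ln \<epsilon> < - 1" using \<epsilon> by (metis exp_gt_zero ln_exp ln_less_cancel_iff)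
    then have l: "1 \<le> \<bar>ln (1 / \<epsilon>)\<bar>" "\<bar>ln (1 / \<epsilon>)\<bar> = - ln \<epsilon>" using \<epsilon> by (simp_all add: ln_div)
    have low: "(1 - \<theta>) * \<epsilon> \<le> \<epsilon> - b" using b by (simp add: algebra_simps)
    moreover have pos: "0 < (1 - \<theta>) * \<epsilon>" using \<theta> \<epsilon> by simp
    ultimately have "ln ((1 - \<theta>) * \<epsilon>) \<le> ln (\<epsilon> - b)" "ln (\<epsilon> - b) \<le> ln \<epsilon>"
      using b by (auto intro!: ln_mono)
    then have "ln (1 - \<theta>) + ln \<epsilon> \<le> ln (\<epsilon> - b)" "ln (\<epsilon> - b) \<le> ln \<epsilon>"
      using \<theta> \<epsilon> by (simp_all add: ln_mult)
    moreover have "ln ((\<epsilon> - b) / e0) = ln (\<epsilon> - b) - ln e0"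
      using low pos False \<open>0 \<le> e0\<close> by (simp add: ln_div)
    ultimately have "\<bar>ln ((\<epsilon> - b) / e0)\<bar> \<le> \<bar>ln (1 / \<epsilon>)\<bar> + C"
      using l \<open>ln \<epsilon> < - 1\<close> unfolding C_def by linarith
    also have "\<dots> \<le> \<bar>ln (1 / \<epsilon>)\<bar> + C * \<bar>ln (1 / \<epsilon>)\<bar>"
      using mult_left_mono[OF l(1), of C] by (simp add: C_def)
    finally show "\<bar>ln ((\<epsilon> - b) / e0)\<bar> \<le> (1 + C) * \<bar>ln (1 / \<epsilon>)\<bar>"
      by (simp add: algebra_simps)
  qed
  then show ?thesis by blast
qed

lemma strongly_convex_query_bound_bigo:
  fixes b1 b5 L \<nu> H e0 \<theta> :: real
  assumes "0 < \<nu>" "0 \<le> e0" "\<theta> < 1" "0 \<le> H"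
  shows "(\<lambda>(\<epsilon>, \<sigma>', s', d'). strongly_convex_query_bound b1 b5 s' d' L \<nu> H e0 \<sigma>' \<epsilon>)
    \<in> O[inf (at_right 0 \<times>\<^sub>F top) (principal
        {(\<epsilon>, \<sigma>', s', d'). 0 \<le> \<sigma>' \<and> b5\<^sup>2 * \<sigma>' * H / \<nu> \<le> \<theta> * \<epsilon>})](\<lambda>(\<epsilon>, \<sigma>', s', d'). real s' * ln (real d') * ln (1 / \<epsilon>))"
proof -
  obtain C where C: "\<forall>\<^sub>F \<epsilon> in at_right 0. \<forall>b. 0 \<le> b \<longrightarrow> b \<le> \<theta> * \<epsilon> \<longrightarrow>
      \<bar>ln ((\<epsilon> - b) / e0)\<bar> \<le> C * \<bar>ln (1 / \<epsilon>)\<bar>"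
    using log_ratio_bigo[OF assms(2,3)] by blast
  define \<Lambda> where "\<Lambda> = ln (24 * L) - ln (\<nu> + 24 * L)"
  have bound: "\<bar>strongly_convex_query_bound b1 b5 s' d' L \<nu> H e0 \<sigma>' \<epsilon>\<bar>
      \<le> (\<bar>b1\<bar> / \<bar>\<Lambda>\<bar> * C) * \<bar>real s' * ln (real d') * ln (1 / \<epsilon>)\<bar>"
    if le: "\<bar>ln ((\<epsilon> - b5\<^sup>2 * \<sigma>' * H / \<nu>) / e0)\<bar> \<le> C * \<bar>ln (1 / \<epsilon>)\<bar>" for s' d' :: nat and \<epsilon> \<sigma>'
  proof -
    have "(\<epsilon> * \<nu> - b5\<^sup>2 * \<sigma>' * H) / (\<nu> * e0) = (\<epsilon> - b5\<^sup>2 * \<sigma>' * H / \<nu>) / e0"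
      using \<open>0 < \<nu>\<close> by (simp add: divide_simps)
    then have "\<bar>strongly_convex_query_bound b1 b5 s' d' L \<nu> H e0 \<sigma>' \<epsilon>\<bar>
        = \<bar>b1\<bar> / \<bar>\<Lambda>\<bar> * \<bar>real s' * ln (real d')\<bar> * \<bar>ln ((\<epsilon> - b5\<^sup>2 * \<sigma>' * H / \<nu>) / e0)\<bar>"
      by (simp add: strongly_convex_query_bound_def \<Lambda>_def abs_mult)
    also have "\<dots> \<le> \<bar>b1\<bar> / \<bar>\<Lambda>\<bar> * \<bar>real s' * ln (real d')\<bar> * (C * \<bar>ln (1 / \<epsilon>)\<bar>)"
      using le by (intro mult_left_mono) auto
    finally show ?thesis by (simp add: abs_mult ac_simps)
  qed
  show ?thesis
  proof (rule bigoI[where c = "\<bar>b1\<bar> / \<bar>\<Lambda>\<bar> * C"])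
    show "\<forall>\<^sub>F v in inf (at_right 0 \<times>\<^sub>F top) (principal
        {(\<epsilon>, \<sigma>', s', d'). 0 \<le> \<sigma>' \<and> b5\<^sup>2 * \<sigma>' * H / \<nu> \<le> \<theta> * \<epsilon>}).
        norm (case v of (\<epsilon>, \<sigma>', s', d') \<Rightarrow> strongly_convex_query_bound b1 b5 s' d' L \<nu> H e0 \<sigma>' \<epsilon>)
        \<le> \<bar>b1\<bar> / \<bar>\<Lambda>\<bar> * C * norm (case v of (\<epsilon>, \<sigma>', s', d') \<Rightarrow> real s' * ln (real d') * ln (1 / \<epsilon>))"
      unfolding eventually_inf_principal eventually_prod_filter
    proof (intro exI conjI allI impI)
      fix \<epsilon> :: real and v :: "real \<times> nat \<times> nat"
      assume \<epsilon>: "\<forall>b. 0 \<le> b \<longrightarrow> b \<le> \<theta> * \<epsilon> \<longrightarrow> \<bar>ln ((\<epsilon> - b) / e0)\<bar> \<le> C * \<bar>ln (1 / \<epsilon>)\<bar>"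
        and dom: "(\<epsilon>, v) \<in> {(\<epsilon>, \<sigma>', s', d'). 0 \<le> \<sigma>' \<and> b5\<^sup>2 * \<sigma>' * H / \<nu> \<le> \<theta> * \<epsilon>}"
      obtain \<sigma>' s' d' where v: "v = (\<sigma>', s', d')" by (cases v)
      have "0 \<le> b5\<^sup>2 * \<sigma>' * H / \<nu>" "b5\<^sup>2 * \<sigma>' * H / \<nu> \<le> \<theta> * \<epsilon>" using dom assms by (auto simp: v)
      with \<epsilon> bound show "norm (case (\<epsilon>, v) of (\<epsilon>, \<sigma>', s', d') \<Rightarrow> strongly_convex_query_bound b1 b5 s' d' L \<nu> H e0 \<sigma>' \<epsilon>)
        \<le> \<bar>b1\<bar> / \<bar>\<Lambda>\<bar> * C * norm (case (\<epsilon>, v) of (\<epsilon>, \<sigma>', s', d') \<Rightarrow> real s' * ln (real d') * ln (1 / \<epsilon>))"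
        by (simp add: v)
    qed (use C in \<open>auto intro: always_eventually\<close>)
  qed
qed

section \<open>Query complexity\<close>

theorem theorem1p9:
  fixes f :: "real^'d \<Rightarrow> real" and grad :: "real^'d \<Rightarrow> real^'d" and hess :: "real^'d \<Rightarrow> real^'d^'d"
    and r F :: "real^'d \<Rightarrow> ereal" and x0 :: "real^'d"
    and s s_exact m n :: nat
    and H L \<sigma> \<alpha> \<delta> b1 b2 b5 \<rho> \<tau> e0 p :: real
  assumes f_convex: "convex_on UNIV f"
    and gradient: "\<And>x. GDERIV f x :> grad x"
    and hessian: "\<And>x. (grad has_derivative (\<lambda>h. hess x *v h)) (at x)"
    and r_convex: "convex_ereal r" and r_not_MInf: "\<And>x. r x \<noteq> -\<infinity>"
    and F: "F = (\<lambda>x. ereal (f x) + r x)"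
    and sparse_gradient: "\<And>x. l0_norm (grad x) \<le> s_exact"
    and sparse_hessian: "\<And>x. entrywise_l1 (hess x) \<le> H" and H_pos: "0 < H"
    and solution_exists: "solutions F \<noteq> {}"
    and L_pos: "0 < L" and lipschitz: "\<And>x y. norm (grad x - grad y) \<le> L * norm (x - y)"
    and sigma_pos: "0 < \<sigma>"
    and x0_dom: "F x0 < \<infinity>"
    and s: "s_exact \<le> s" "0 < s" "s \<le> CARD('d)"
    and alpha: "\<alpha> = 1 / L"
    and delta: "\<delta> = 2 * sqrt (\<sigma> / H)"
    and prox_computable: "\<And>v. \<exists>q. is_prox \<alpha> r v q"
    and b1: "0 < b1" and b2: "0 < b2"
    and m: "m = nat \<lfloor>b1 * real s * ln (real CARD('d) / real s)\<rfloor>"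
    and p: "p = 1 - 2 * (real s / real CARD('d)) powr (b2 * real s)"
    and RIP_theorem:
      "measure_pmf.prob (rademacher_family m) {z :: nat \<Rightarrow> real^'d. good_matrix s m z} \<ge> p"
    and rho: "0 \<le> \<rho>" "\<rho> < 1" and tau: "0 < \<tau>"
    and cosamp: "cosamp_guarantee TYPE('d) s m \<rho> \<tau>"
    and n_large: "\<And>z \<xi> x k. \<lbrakk>z \<in> set_pmf (rademacher_family m); good_matrix s m z;
        bounded_noise \<sigma> \<xi>; zoro_run f r s m n \<alpha> \<delta> x0 z \<xi> x\<rbrakk>
        \<Longrightarrow> \<rho> ^ n * norm (grad (x k)) \<le> \<tau> * sqrt (\<sigma> * H)"
    and b5: "b5 = cs_const \<tau>"
    and e0: "e0 = real_of_ereal (F x0 - Fmin F)"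
  shows "(coercive F \<and> subdiff_coercive F (\<lambda>x. (\<lambda>u. grad x + u) ` subdifferential r x) \<longrightarrow>
      (\<exists>R0 \<ge> 0. measure_pmf.prob (rademacher_family m)
        {z :: nat \<Rightarrow> real^'d. \<forall>\<xi> x. bounded_noise \<sigma> \<xi> \<longrightarrow> zoro_run f r s m n \<alpha> \<delta> x0 z \<xi> x \<longrightarrow>
           (\<forall>k. norm (x k - proj_sol F (x k)) \<le> R0) \<and>
           (\<forall>R \<epsilon>. (\<forall>k. norm (x k - proj_sol F (x k)) \<le> R) \<longrightarrow>
              0 < \<epsilon> \<longrightarrow> b5 * R * sqrt (\<sigma> * H) \<le> \<epsilon> \<longrightarrow>
              eps_optimal_within F m x (coercive_query_bound b1 s CARD('d) L e0 R \<epsilon>) \<epsilon>)} \<ge> p))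
    \<and> (\<forall>\<nu> > 0. restricted_strongly_convex F \<nu> \<longrightarrow>
      measure_pmf.prob (rademacher_family m)
        {z :: nat \<Rightarrow> real^'d. \<forall>\<xi> x. bounded_noise \<sigma> \<xi> \<longrightarrow> zoro_run f r s m n \<alpha> \<delta> x0 z \<xi> x \<longrightarrow>
           (\<forall>\<epsilon>. b5\<^sup>2 * \<sigma> * H / \<nu> < \<epsilon> \<longrightarrow>
              eps_optimal_within F m x
                (strongly_convex_query_bound b1 b5 s CARD('d) L \<nu> H e0 \<sigma> \<epsilon>) \<epsilon>)} \<ge> p
      \<and> (\<forall>\<theta> \<in> {0<..<1::real}.
          (\<lambda>(\<epsilon>, \<sigma>', s', d'). strongly_convex_query_bound b1 b5 s' d' L \<nu> H e0 \<sigma>' \<epsilon>)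
          \<in> O[inf (at_right 0 \<times>\<^sub>F top) (principal
                {(\<epsilon>, \<sigma>', s', d'). 0 \<le> \<sigma>' \<and> b5\<^sup>2 * \<sigma>' * H / \<nu> \<le> \<theta> * \<epsilon>})](\<lambda>(\<epsilon>, \<sigma>', s', d'). real s' * ln (real d') * ln (1 / \<epsilon>))))"
proof -
  interpret composite f grad r F L
    using f_convex gradient L_pos lipschitz r_convex r_not_MInf F solution_exists x0_dom
      prox_computable[unfolded alpha] by unfold_locales auto
  define \<eta> where "\<eta> = 3 * \<tau> * sqrt (\<sigma> * H)"
  have "0 \<le> \<eta>" using tau sigma_pos H_pos by (simp add: \<eta>_def)
  have x0: "x0 \<in> dom" using x0_dom by (simp add: in_dom_iff)
  have e0_gap: "e0 = gap x0" by (simp add: e0 F_minus_Fmin[OF x0])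
  have run: "x 0 = x0 \<and> (\<forall>k. inexact_step \<eta> (x k) (x (Suc k)))"
    if z: "z \<in> set_pmf (rademacher_family m)" and good: "good_matrix s m z"
      and noise: "bounded_noise \<sigma> \<xi>" and run: "zoro_run f r s m n \<alpha> \<delta> x0 z \<xi> x" for z \<xi> x
  proof (intro conjI allI)
    show "x 0 = x0" using run by (simp add: zoro_run_def)
    fix k
    obtain g where g: "cosamp_output s m z (finite_differences f m \<delta> z (\<xi> k) (x k)) n g"
      and prox: "is_prox \<alpha> r (x k - \<alpha> *\<^sub>R g) (x (Suc k))"
      using run by (auto simp: zoro_run_def)
    have "norm (g - grad (x k)) \<le> 3 * \<tau> * sqrt (\<sigma> * H)"
    proof (rule cosamp_gradient_error[OF gradient hessian sparse_hessian H_pos _ sigma_pos _ _ cosamp tau good])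
      show "z i $ j \<in> {-1, 1}" if "i < m" for i j by (rule rademacher_family_signs[OF z that])
      show "\<bar>\<xi> k i\<bar> \<le> \<sigma>" for i using noise by (simp add: bounded_noise_def)
      show "l0_norm (grad (x k)) \<le> s" using sparse_gradient s(1) order.trans by blast
      show "cosamp_output s m z (finite_differences f m (2 * sqrt (\<sigma> / H)) z (\<xi> k) (x k)) n g"
        using g by (simp add: delta)
      show "\<rho> ^ n * norm (grad (x k)) \<le> \<tau> * sqrt (\<sigma> * H)" by (rule n_large[OF z good noise run])
    qed
    then show "inexact_step \<eta> (x k) (x (Suc k))"
      unfolding \<eta>_def by (rule inexact_step_prox[OF prox[unfolded alpha]])
  qed
  have dom_run: "x k \<in> dom" if "x 0 = x0" "\<And>k. inexact_step \<eta> (x k) (x (Suc k))" for x k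
    using x0 inexact_step_dom[OF that(2)] that(1) by (cases k) auto
  \<comment> \<open>The iterations paid for by a budget of \<open>X\<close> blocks of \<open>b1 s ln d\<close> queries.\<close>
  define iters where "iters X = nat \<lceil>b1 * real s * ln (real CARD('d)) * X / real (m + 1)\<rceil>" for X
  have iters: "X \<le> 2 * real (iters X)" if good: "good_matrix s m z" for X and z :: "nat \<Rightarrow> real^'d"
  \<comment> \<open>A negative budget arises under strong convexity when already \<open>x0\<close> is good enough.\<close>
  proof (cases "0 \<le> X")
    case True
    then show ?thesis
      unfolding iters_def
      using s b1 by (intro iterations_within_query_bound[OF good_matrix_rows_pos[OF good s(2)] m]) auto
  qed simp
  show ?thesis
  proof (intro conjI impI allI ballI)
    assume "coercive F \<and> subdiff_coercive F (\<lambda>x. (\<lambda>u. grad x + u) ` subdifferential r x)"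
    then obtain R0 where "0 \<le> R0" and R0: "\<And>x k. x 0 = x0 \<Longrightarrow>
        (\<forall>k. inexact_step \<eta> (x k) (x (Suc k))) \<Longrightarrow> D (x k) \<le> R0"
      using iterates_bounded[OF _ _ x0] by blast
    show "\<exists>R0\<ge>0. p \<le> measure_pmf.prob (rademacher_family m)
        {z :: nat \<Rightarrow> real^'d. \<forall>\<xi> x. bounded_noise \<sigma> \<xi> \<longrightarrow> zoro_run f r s m n \<alpha> \<delta> x0 z \<xi> x \<longrightarrow>
           (\<forall>k. norm (x k - proj_sol F (x k)) \<le> R0) \<and>
           (\<forall>R \<epsilon>. (\<forall>k. norm (x k - proj_sol F (x k)) \<le> R) \<longrightarrow>
              0 < \<epsilon> \<longrightarrow> b5 * R * sqrt (\<sigma> * H) \<le> \<epsilon> \<longrightarrow>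
              eps_optimal_within F m x (coercive_query_bound b1 s CARD('d) L e0 R \<epsilon>) \<epsilon>)}"
    proof (intro exI[of _ R0] conjI \<open>0 \<le> R0\<close> prob_ge_if_suffices_on_support[OF RIP_theorem] CollectI allI impI)
      fix z \<xi> x
      assume z: "z \<in> set_pmf (rademacher_family m)" and good: "good_matrix s m z"
        and noise: "bounded_noise \<sigma> \<xi>" and zoro: "zoro_run f r s m n \<alpha> \<delta> x0 z \<xi> x"
      note steps = run[OF z good noise zoro]
      show "norm (x k - proj_sol F (x k)) \<le> R0" for k
        using R0[of x k] steps by (simp add: P_def)
      fix R \<epsilon> :: real
      assume R: "\<forall>k. norm (x k - proj_sol F (x k)) \<le> R" and "0 < \<epsilon>"
        and \<epsilon>: "b5 * R * sqrt (\<sigma> * H) \<le> \<epsilon>"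
      define X where "X = 36 * L * R\<^sup>2 / \<epsilon> + max 0 (ln e0)"
      have "18 * L * R\<^sup>2 / \<epsilon> \<le> real (iters X)"
        using iters[OF good, of X] by (simp add: X_def)
      moreover have "10 * \<eta> * R \<le> \<epsilon>" using \<epsilon> by (simp add: \<eta>_def b5 cs_const_def mult_ac)
      ultimately obtain k where k: "k \<le> iters X" "gap (x k) \<le> \<epsilon>"
        using sublinear_rate[of \<eta> x R \<epsilon> "iters X"] steps x0 R \<open>0 \<le> \<eta>\<close> \<open>0 < \<epsilon>\<close>
        by (auto simp: P_def)
      then show "eps_optimal_within F m x (coercive_query_bound b1 s CARD('d) L e0 R \<epsilon>) \<epsilon>"
        unfolding eps_optimal_within_def coercive_query_bound_def X_def[symmetric] iters_def[symmetric]
        using steps dom_run by (auto simp: F_minus_Fmin)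
    qed
  next
    fix \<nu> :: real
    assume "0 < \<nu>" and rsc: "restricted_strongly_convex F \<nu>"
    have growth: "\<nu> / 2 * (D y)\<^sup>2 \<le> gap y" if "y \<in> dom" for y
      using rsc F_minus_Fmin[OF that] unfolding restricted_strongly_convex_def P_def
      by (metis ereal_less_eq(3))
    have B: "100 * (\<eta>\<^sup>2 / \<nu>) = b5\<^sup>2 * \<sigma> * H / \<nu>"
      using sigma_pos H_pos by (simp add: \<eta>_def b5 cs_const_def power_mult_distrib)
    show "p \<le> measure_pmf.prob (rademacher_family m)
        {z :: nat \<Rightarrow> real^'d. \<forall>\<xi> x. bounded_noise \<sigma> \<xi> \<longrightarrow> zoro_run f r s m n \<alpha> \<delta> x0 z \<xi> x \<longrightarrow>
           (\<forall>\<epsilon>. b5\<^sup>2 * \<sigma> * H / \<nu> < \<epsilon> \<longrightarrow>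
              eps_optimal_within F m x
                (strongly_convex_query_bound b1 b5 s CARD('d) L \<nu> H e0 \<sigma> \<epsilon>) \<epsilon>)}"
    proof (intro prob_ge_if_suffices_on_support[OF RIP_theorem] CollectI allI impI)
      fix z \<xi> x and \<epsilon> :: real
      assume z: "z \<in> set_pmf (rademacher_family m)" and good: "good_matrix s m z"
        and noise: "bounded_noise \<sigma> \<xi>" and zoro: "zoro_run f r s m n \<alpha> \<delta> x0 z \<xi> x"
        and \<epsilon>: "b5\<^sup>2 * \<sigma> * H / \<nu> < \<epsilon>"
      note steps = run[OF z good noise zoro]
      define X where "X = ln ((\<epsilon> * \<nu> - b5\<^sup>2 * \<sigma> * H) / (\<nu> * e0)) / (ln (24 * L) - ln (\<nu> + 24 * L))"
      have "(\<epsilon> - 100 * (\<eta>\<^sup>2 / \<nu>)) / gap (x 0) = (\<epsilon> * \<nu> - b5\<^sup>2 * \<sigma> * H) / (\<nu> * e0)"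
        unfolding B using \<open>0 < \<nu>\<close> steps by (simp add: e0_gap divide_simps)
      then have "\<exists>k\<le>iters X. gap (x k) \<le> \<epsilon>"
        using steps x0 \<epsilon>[folded B] iters[OF good, of X] growth \<open>0 < \<nu>\<close>
        by (intro linear_rate[of \<eta> x \<nu>]) (simp_all add: X_def)
      then show "eps_optimal_within F m x
          (strongly_convex_query_bound b1 b5 s CARD('d) L \<nu> H e0 \<sigma> \<epsilon>) \<epsilon>"
        unfolding eps_optimal_within_def strongly_convex_query_bound_def times_divide_eq_right[symmetric]
          X_def[symmetric]
        using steps dom_run by (auto simp: F_minus_Fmin iters_def)
    qed
    fix \<theta> :: real
    assume "\<theta> \<in> {0<..<1}"
    then show "(\<lambda>(\<epsilon>, \<sigma>', s', d'). strongly_convex_query_bound b1 b5 s' d' L \<nu> H e0 \<sigma>' \<epsilon>)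
          \<in> O[inf (at_right 0 \<times>\<^sub>F top) (principal
                {(\<epsilon>, \<sigma>', s', d'). 0 \<le> \<sigma>' \<and> b5\<^sup>2 * \<sigma>' * H / \<nu> \<le> \<theta> * \<epsilon>})](\<lambda>(\<epsilon>, \<sigma>', s', d'). real s' * ln (real d') * ln (1 / \<epsilon>))"
      using gap_nonneg[OF x0] H_pos \<open>0 < \<nu>\<close>
      by (intro strongly_convex_query_bound_bigo) (auto simp: e0_gap)
  qed
qed

end
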